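(* Let $\mathcal{M}$ be an $\mathbb{A}$-submodule of $\mathbb{A}^K$, $a_1,\dots,a_K\in\mathbb{Z}^n$, and $I,J\subseteq\{1,\dots,K\}$. There exists $\boldsymbol f\in\mathcal{M}\cap(\mathbb{A}^+)^K$ satisfying $$(O_v\cup J)\cap M_v(I,\boldsymbol f)\neq\emptyset\quad\text{for every }v\in\mathbb{R}^n\setminus\{0\}$$ if and only if both of the following hold: (LocR) for every $r\in\mathbb{R}_{>0}^n$ there exists $\boldsymbol f_r\in\mathcal{M}$ with $\boldsymbol f_r(r)\in\mathbb{R}_{>0}^K$; (LocInf) for every $v\in\mathbb{R}^n\setminus\{0\}$ there exists $\boldsymbol f_v\in\mathcal{M}$ such that (a) $\mathrm{in}_v(\boldsymbol f_v)\in(\mathbb{A}^+)^K$, and (b) writing $I'=M_v(I,\boldsymbol f_v)$ and $J'=O_v\cup J$, we have $(O_w\cup J')\cap M_w(I',\mathrm{in}_v(\boldsymbol f_v))\neq\emptyset$ for every $w\in\mathbb{R}^n\setminus\{0\}$.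
   Context: $\mathbb{A}=\mathbb{R}[X_1^{\pm1},\dots,X_n^{\pm1}]$, $\mathbb{A}^+=\mathbb{R}_{\ge0}[X_1^{\pm1},\dots,X_n^{\pm1}]\setminus\{0\}$ (nonzero Laurent polynomials with nonnegative coefficients); $X^b=X_1^{b_1}\cdots X_n^{b_n}$. For $f=\sum c_bX^b\ne0$ and $v\in\mathbb{R}^n\setminus\{0\}$: $\deg_v(f)=\max\{v\cdot b:c_b\ne0\}$, $\deg_v(0)=-\infty$, and $\mathrm{in}_v(f)=\sum_{v\cdot b=\deg_v(f)}c_bX^b$ (with $\mathrm{in}_v(0)=0$), applied componentwise to vectors. $M_v(I,\boldsymbol f)=\{i\in I:\deg_v(f_i)=\max_{i'\in I}\deg_v(f_{i'})\}$; $O_v=\{i\in\{1,\dots,K\}:a_i\not\perp v\}$. $\boldsymbol f(r)$ denotes componentwise evaluation. *)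

theory Defs
  imports "HOL-Analysis.Analysis" "HOL-Library.Poly_Mapping" "HOL-Library.Extended_Real"
begin

text \<open>Laurent polynomials in n variables with real coefficients:
  finitely supported maps from exponent vectors in Z^n to R, with
  convolution as multiplication. The variables are indexed by a finite type 'n.\<close>
type_synonym 'n laurent = "(int ^ 'n) \<Rightarrow>\<^sub>0 real"

definition vdot :: "real ^ 'n \<Rightarrow> int ^ 'n \<Rightarrow> real" where
  "vdot v b = (\<Sum>i\<in>UNIV. v $ i * real_of_int (b $ i))"

definition Apos :: "'n::finite laurent set" where
  "Apos = {f. f \<noteq> 0 \<and> (\<forall>b. Poly_Mapping.lookup f b \<ge> 0)}"

definition degv :: "real ^ 'n \<Rightarrow> 'n::finite laurent \<Rightarrow> ereal" where
  "degv v f = (if f = 0 then -\<infinity> else ereal (Max ((\<lambda>b. vdot v b) ` Poly_Mapping.keys f)))"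

definition initv :: "real ^ 'n \<Rightarrow> 'n::finite laurent \<Rightarrow> 'n laurent" where
  "initv v f = Abs_poly_mapping (\<lambda>b. if ereal (vdot v b) = degv v f then Poly_Mapping.lookup f b else 0)"

definition evalL :: "'n::finite laurent \<Rightarrow> real ^ 'n \<Rightarrow> real" where
  "evalL f r = (\<Sum>b\<in>Poly_Mapping.keys f. Poly_Mapping.lookup f b * (\<Prod>i\<in>UNIV. (r $ i) powi (b $ i)))"

definition Mv :: "real ^ 'n \<Rightarrow> 'k set \<Rightarrow> ('k \<Rightarrow> 'n::finite laurent) \<Rightarrow> 'k set" where
  "Mv v I f = {i\<in>I. degv v (f i) = Max ((\<lambda>i'. degv v (f i')) ` I)}"

definition Ov :: "('k \<Rightarrow> int ^ 'n) \<Rightarrow> real ^ 'n \<Rightarrow> 'k set" where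
  "Ov a v = {i. vdot v (a i) \<noteq> 0}"

definition is_submodule :: "('k \<Rightarrow> 'n::finite laurent) set \<Rightarrow> bool" where
  "is_submodule M \<longleftrightarrow> (\<lambda>_. 0) \<in> M \<and> (\<forall>f\<in>M. \<forall>g\<in>M. (\<lambda>i. f i + g i) \<in> M)
     \<and> (\<forall>c. \<forall>f\<in>M. (\<lambda>i. c * f i) \<in> M)"

end

(* Idea.  Near infinity the sphere of directions is compact, so finitely many of the local solutions
   suffice; adding them up with monomial multipliers X^b, b close to rho times the points of a fine net,
   leaves in each direction v only the summands attached to directions near v at the top v-degree.
   This gives f in M that has all required properties at infinity, in particular f(r) > 0 outside a
   compact set.  On the compact rest, (LocR) provides finitely many further elements of M, combined
   with bump functions.  Finally everything is multiplied by truncated Gaussians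
   sum_b phi(b/N) exp(-|b|^2/2N) X^b: up to the factor exp(-|b|^2/2N), the coefficient of the sum at b
   is approximately its value at r = exp(b/N), hence positive, and for |b|/N large the top exponents of
   f in the direction b dominate, whatever the truncation does. *)

theory Submission
  imports Defs
begin

section \<open>Exponents and coefficients\<close>

text \<open>Positive values do not make coefficients nonnegative, and bump functions are not Laurent
  polynomials; the Gaussian multipliers bridge both gaps. As |b - c|^2 = |b|^2 - 2 b.c + |c|^2,
  shifting a Gaussian of variance N by c multiplies it at b by r^c with r = exp(b/N), up to
  exp(-|c|^2/2N). Convolution thus imitates evaluation, and a slowly varying factor phi(b/N) hardly
  disturbs this. Finite support forces a truncation. Cutting along a ball is harmless: for |b|/N
  large, the shifts b - c with the larger b.c are the shorter ones, so the dominant positive terms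
  survive the cut longest. (LocInf) speaks of one direction at a time. It spreads to a neighbourhood
  because in_w(in_v(f)) = in_u(f) and O_u is the union of O_v and O_w for u = v + eps w with eps > 0
  small; this is why O_v is joined to J in (b).\<close>

definition exponent_vec :: "int ^ 'n \<Rightarrow> real ^ 'n" where
  "exponent_vec b = (\<chi> i. real_of_int (b $ i))"

lemma exponent_vec_add: "exponent_vec (b + c) = exponent_vec b + exponent_vec c"
  by (simp add: exponent_vec_def vec_eq_iff)

lemma exponent_vec_diff: "exponent_vec (b - c) = exponent_vec b - exponent_vec c"
  by (simp add: exponent_vec_def vec_eq_iff)

lemma vdot_eq_inner: "vdot v b = v \<bullet> exponent_vec b"
  by (simp add: vdot_def exponent_vec_def inner_vec_def)

lemma vdot_add_right: "vdot v (b + c) = vdot v b + vdot v c"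
  by (simp add: vdot_eq_inner exponent_vec_add inner_add_right)

lemma vdot_add_left: "vdot (v + w) b = vdot v b + vdot w b"
  by (simp add: vdot_eq_inner inner_add_left)

lemma vdot_scaleR_left: "vdot (s *\<^sub>R v) b = s * vdot v b"
  by (simp add: vdot_eq_inner)

lemma finite_bounded_exponents: "finite {b :: int ^ 'n::finite. norm (exponent_vec b) \<le> r}"
proof (rule finite_subset)
  let ?m = "\<lceil>r\<rceil>"
  let ?F = "{f :: 'n \<Rightarrow> int. \<forall>i. (i \<in> UNIV \<longrightarrow> f i \<in> {- ?m..?m}) \<and> (i \<notin> UNIV \<longrightarrow> f i = 0)}"
  show "finite ((\<lambda>f. \<chi> i. f i) ` ?F)"
    by (intro finite_imageI finite_set_of_finite_funs) auto
  show "{b :: int ^ 'n. norm (exponent_vec b) \<le> r} \<subseteq> (\<lambda>f. \<chi> i. f i) ` ?F"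
  proof
    fix b :: "int ^ 'n"
    assume "b \<in> {b. norm (exponent_vec b) \<le> r}"
    then have "\<bar>real_of_int (b $ i)\<bar> \<le> r" for i
      using component_le_norm_cart[of "exponent_vec b" i] by (simp add: exponent_vec_def)
    then have "b $ i \<in> {- ?m..?m}" for i
      by (simp add: abs_le_iff) (smt (verit) le_of_int_ceiling of_int_le_iff of_int_minus)
    then show "b \<in> (\<lambda>f. \<chi> i. f i) ` ?F"
      by (intro image_eqI[where x = "\<lambda>i. b $ i"]) auto
  qed
qed

text \<open>Rounding down moves each coordinate by less than 1. The crude l1 bound is enough,
  because rounding errors are later beaten by a large scale \<open>\<rho>\<close> or
  \<open>N\<close>.\<close>

lemma exponent_near:
  fixes x :: "real ^ 'n::finite"
  shows "\<exists>b. norm (exponent_vec b - x) \<le> real CARD('n)"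
proof
  let ?b = "\<chi> i. \<lfloor>x $ i\<rfloor>"
  have "norm (exponent_vec ?b - x) \<le> (\<Sum>i\<in>UNIV. \<bar>(exponent_vec ?b - x) $ i\<bar>)"
    by (rule norm_le_l1_cart)
  also have "\<dots> \<le> (\<Sum>i\<in>(UNIV :: 'n set). 1)"
    by (intro sum_mono) (simp add: exponent_vec_def, linarith)
  finally show "norm (exponent_vec ?b - x) \<le> real CARD('n)" by simp
qed

text \<open>Summing over the support of the right factor presents a multiplier \<open>g\<close> as a
  function sampled at the shifts \<open>b - c\<close> of the target exponent.\<close>

lemma lookup_times_sum:
  fixes f g :: "'a::ab_group_add \<Rightarrow>\<^sub>0 'b::comm_semiring_0"
  shows "Poly_Mapping.lookup (g * f) b =
    (\<Sum>c\<in>Poly_Mapping.keys f. Poly_Mapping.lookup g (b - c) * Poly_Mapping.lookup f c)"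
proof -
  have "(\<Sum>q. Poly_Mapping.lookup g q when b = c + q) = Poly_Mapping.lookup g (b - c)" for c
  proof -
    have "(\<lambda>q. Poly_Mapping.lookup g q when b = c + q) =
        (\<lambda>q. Poly_Mapping.lookup g q when b - c = q)"
      by (intro ext) (auto simp: when_def algebra_simps)
    then show ?thesis by (simp only: Sum_any_when_equal')
  qed
  then have "Poly_Mapping.lookup (f * g) b =
      (\<Sum>c. Poly_Mapping.lookup f c * Poly_Mapping.lookup g (b - c))"
    by (simp add: lookup_mult)
  also have "\<dots> = (\<Sum>c\<in>Poly_Mapping.keys f. Poly_Mapping.lookup f c * Poly_Mapping.lookup g (b - c))"
    by (rule Sum_any.expand_superset) (auto simp: in_keys_iff)
  finally show ?thesis by (simp add: mult.commute)
qed

definition laurent_of_fun :: "(int ^ 'n) set \<Rightarrow> (int ^ 'n \<Rightarrow> real) \<Rightarrow> 'n::finite laurent" where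
  "laurent_of_fun B h = (\<Sum>b\<in>B. Poly_Mapping.single b (h b))"

lemma lookup_laurent_of_fun:
  "finite B \<Longrightarrow> Poly_Mapping.lookup (laurent_of_fun B h) b = (if b \<in> B then h b else 0)"
  by (simp add: laurent_of_fun_def lookup_sum lookup_single when_def)

text \<open>Logarithmic coordinates r = exp u turn the positive orthant into the whole space and
  monomials into exponentials of linear forms, the factors that shifts of a Gaussian
  produce.\<close>

definition log_eval :: "'n::finite laurent \<Rightarrow> real ^ 'n \<Rightarrow> real" where
  "log_eval f u = (\<Sum>c\<in>Poly_Mapping.keys f. Poly_Mapping.lookup f c * exp (u \<bullet> exponent_vec c))"

lemma evalL_exp: "evalL f (\<chi> i. exp (u $ i)) = log_eval f u"
proof -
  have "exp x powi m = exp (x * real_of_int m)" for x :: real and m :: int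
    by (simp add: exp_power_int mult.commute)
  then have "(\<Prod>i\<in>UNIV. exp (u $ i) powi (c $ i)) = exp (u \<bullet> exponent_vec c)" for c
    by (simp add: inner_vec_def exponent_vec_def exp_sum)
  then show ?thesis
    by (simp add: evalL_def log_eval_def)
qed

lemma isCont_log_eval: "isCont (log_eval f) u"
  unfolding log_eval_def by (intro continuous_intros)

section \<open>Initial forms through exponents\<close>

text \<open>Encodes \<open>initv v f \<in> Apos\<close> by strict comparisons of exponents, a form
  that visibly survives small changes of \<open>v\<close>.\<close>

definition posdir :: "real ^ 'n \<Rightarrow> 'n::finite laurent \<Rightarrow> bool" where
  "posdir v f \<longleftrightarrow> f \<noteq> 0 \<and>
    (\<forall>b. Poly_Mapping.lookup f b < 0 \<longrightarrow> (\<exists>b'\<in>Poly_Mapping.keys f. vdot v b < vdot v b'))"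

text \<open>Encodes \<open>L \<inter> Mv v I f \<noteq> {}\<close> without extended reals and
  \<open>Max\<close>; a component of degree -infinity is one with an empty set of keys.\<close>

definition dominant ::
  "'k set \<Rightarrow> 'k set \<Rightarrow> real ^ 'n \<Rightarrow> ('k \<Rightarrow> 'n::finite laurent) \<Rightarrow> bool" where
  "dominant I L v f \<longleftrightarrow> (\<exists>i0\<in>I \<inter> L. \<forall>i\<in>I. \<forall>b\<in>Poly_Mapping.keys (f i).
    \<exists>b0\<in>Poly_Mapping.keys (f i0). vdot v b \<le> vdot v b0)"

lemma degv_le_iff:
  "degv v f \<le> degv v g \<longleftrightarrow>
    (\<forall>b\<in>Poly_Mapping.keys f. \<exists>b0\<in>Poly_Mapping.keys g. vdot v b \<le> vdot v b0)"
proof (cases "f = 0 \<or> g = 0")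
  case True
  then show ?thesis
    by (auto simp: degv_def)
next
  case False
  then have "Max (vdot v ` Poly_Mapping.keys f) \<le> Max (vdot v ` Poly_Mapping.keys g) \<longleftrightarrow>
      (\<forall>b\<in>Poly_Mapping.keys f. vdot v b \<le> Max (vdot v ` Poly_Mapping.keys g))"
    by (subst Max_le_iff) auto
  with False show ?thesis
    by (simp add: degv_def Max_ge_iff)
qed

lemma mem_Mv_iff:
  fixes I :: "'k::finite set"
  shows "i \<in> Mv v I f \<longleftrightarrow> i \<in> I \<and> (\<forall>i'\<in>I. degv v (f i') \<le> degv v (f i))"
  unfolding Mv_def by (auto intro!: Max_eqI[symmetric])

lemma dominant_iff_Mv:
  fixes I :: "'k::finite set"
  shows "dominant I L v f \<longleftrightarrow> L \<inter> Mv v I f \<noteq> {}"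
  unfolding dominant_def disjoint_iff by (simp add: mem_Mv_iff degv_le_iff) blast

lemma ereal_vdot_eq_degv_iff:
  "b \<in> Poly_Mapping.keys f \<Longrightarrow>
    ereal (vdot v b) = degv v f \<longleftrightarrow> (\<forall>b'\<in>Poly_Mapping.keys f. vdot v b' \<le> vdot v b)"
  by (auto simp: degv_def eq_Max_iff)

lemma lookup_initv:
  "Poly_Mapping.lookup (initv v f) b =
    (if \<forall>b'\<in>Poly_Mapping.keys f. vdot v b' \<le> vdot v b then Poly_Mapping.lookup f b else 0)"
proof -
  have "finite {b. (if ereal (vdot v b) = degv v f then Poly_Mapping.lookup f b else 0) \<noteq> 0}"
    by (rule finite_subset[OF _ finite_keys[of f]]) (auto simp: in_keys_iff)
  then have "Poly_Mapping.lookup (initv v f) b =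
      (if ereal (vdot v b) = degv v f then Poly_Mapping.lookup f b else 0)"
    by (simp add: initv_def Abs_poly_mapping_inverse)
  \<comment> \<open>Outside the support of \<open>f\<close> both conditionals yield 0, so only keys
    need the comparison of degrees.\<close>
  then show ?thesis
    using ereal_vdot_eq_degv_iff[of b f v] by (auto simp: in_keys_iff)
qed

lemma keys_initv:
  "Poly_Mapping.keys (initv v f) =
    {b \<in> Poly_Mapping.keys f. \<forall>b'\<in>Poly_Mapping.keys f. vdot v b' \<le> vdot v b}"
  by (auto simp: in_keys_iff lookup_initv split: if_splits)

lemma ex_top_key:
  assumes "f \<noteq> 0"
  shows "\<exists>b\<in>Poly_Mapping.keys f. \<forall>b'\<in>Poly_Mapping.keys f. vdot v b' \<le> vdot v b"
proof -
  obtain b where "b \<in> Poly_Mapping.keys f" "vdot v b = Max (vdot v ` Poly_Mapping.keys f)"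
    using Max_in[of "vdot v ` Poly_Mapping.keys f"] assms by fastforce
  then show ?thesis by (intro bexI[of _ b]) auto
qed

lemma initv_mem_Apos_iff: "initv v f \<in> Apos \<longleftrightarrow> posdir v f"
proof
  assume "initv v f \<in> Apos"
  then have nonneg: "\<And>b. Poly_Mapping.lookup (initv v f) b \<ge> 0" and "initv v f \<noteq> 0"
    by (auto simp: Apos_def)
  then have "Poly_Mapping.keys f \<noteq> {}"
    using keys_initv[of v f] by (auto simp del: keys_eq_empty simp flip: keys_eq_empty)
  moreover have "\<exists>b'\<in>Poly_Mapping.keys f. vdot v b < vdot v b'" if "Poly_Mapping.lookup f b < 0" for b
    using nonneg[of b] that by (auto simp: lookup_initv not_le split: if_splits)
  ultimately show "posdir v f" by (auto simp: posdir_def)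
next
  assume pos: "posdir v f"
  obtain b where "b \<in> Poly_Mapping.keys (initv v f)"
    using pos ex_top_key[of f v] by (auto simp: posdir_def keys_initv)
  then have "initv v f \<noteq> 0" by auto
  moreover have "Poly_Mapping.lookup f b \<ge> 0"
    if "\<forall>b'\<in>Poly_Mapping.keys f. vdot v b' \<le> vdot v b" for b
    using pos that unfolding posdir_def by (meson not_le)
  then have "Poly_Mapping.lookup (initv v f) b \<ge> 0" for b
    by (simp add: lookup_initv)
  ultimately show "initv v f \<in> Apos" by (simp add: Apos_def)
qed

lemma posdir_top_key_pos:
  assumes "posdir v f" "c \<in> Poly_Mapping.keys f" "\<forall>c'\<in>Poly_Mapping.keys f. vdot v c' \<le> vdot v c"
  shows "Poly_Mapping.lookup f c > 0"
proof -
  have "\<not> Poly_Mapping.lookup f c < 0"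
    using assms(1,3) unfolding posdir_def by (meson not_le)
  then show ?thesis using assms(2) by (simp add: in_keys_iff)
qed

lemma posdir_Apos: "f \<in> Apos \<Longrightarrow> posdir v f"
  by (auto simp: posdir_def Apos_def not_less[symmetric])

lemma posdir_scaleR: "s > 0 \<Longrightarrow> posdir (s *\<^sub>R v) f \<longleftrightarrow> posdir v f"
  by (simp add: posdir_def vdot_scaleR_left)

lemma dominant_scaleR: "s > 0 \<Longrightarrow> dominant I L (s *\<^sub>R v) f \<longleftrightarrow> dominant I L v f"
  by (simp add: dominant_def vdot_scaleR_left)

lemma Ov_scaleR: "s > 0 \<Longrightarrow> Ov a (s *\<^sub>R v) = Ov a v"
  by (simp add: Ov_def vdot_scaleR_left)

text \<open>The perturbation behind \<open>in\<^sub>w \<circ> in\<^sub>v = in\<^bsub>v+\<epsilon>w\<^esub>\<close>.\<close>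

lemma eventually_vdot_less:
  assumes "vdot v b < vdot v b'"
  shows "eventually (\<lambda>v'. vdot v' b < vdot v' b') (nhds v)"
proof -
  have "open {v'. vdot v' b < vdot v' b'}"
    unfolding vdot_eq_inner by (intro open_Collect_less continuous_intros)
  with assms show ?thesis
    by (auto simp: eventually_nhds)
qed

lemma eventually_order_preserved:
  fixes v :: "real ^ 'n::finite"
  assumes "finite E"
  shows "eventually (\<lambda>v'. \<forall>b\<in>E. \<forall>b'\<in>E. vdot v b < vdot v b' \<longrightarrow> vdot v' b < vdot v' b') (nhds v)"
proof -
  have "eventually (\<lambda>v'. vdot v b < vdot v b' \<longrightarrow> vdot v' b < vdot v' b') (nhds v)" for b b'
    by (cases "vdot v b < vdot v b'") (simp_all add: eventually_vdot_less)
  then show ?thesis using assms by (intro eventually_ball_finite ballI)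
qed

lemma eventually_Ov_mono:
  fixes v :: "real ^ 'n::finite" and a :: "'k::finite \<Rightarrow> int ^ 'n"
  shows "eventually (\<lambda>v'. Ov a v \<subseteq> Ov a v') (nhds v)"
proof -
  have "eventually (\<lambda>v'. vdot v (a i) \<noteq> 0 \<longrightarrow> vdot v' (a i) \<noteq> 0) (nhds v)" for i
  proof (cases "vdot v (a i) = 0")
    case False
    have "open {v'. vdot v' (a i) \<noteq> 0}"
      unfolding vdot_eq_inner by (intro open_Collect_neq continuous_intros)
    with False show ?thesis by (auto simp: eventually_nhds)
  qed simp
  then have "eventually (\<lambda>v'. \<forall>i. vdot v (a i) \<noteq> 0 \<longrightarrow> vdot v' (a i) \<noteq> 0) (nhds v)"
    by (rule eventually_all_finite)
  then show ?thesis by eventually_elim (auto simp: Ov_def)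
qed

section \<open>Local conditions\<close>

text \<open>Both requirements at infinity in direction \<open>v\<close>, phrased for
  \<open>f\<close> itself and not for its initial forms. Positive scaling of \<open>v\<close>
  changes nothing, so unit vectors suffice later.\<close>

definition good_at ::
  "('k \<Rightarrow> int ^ 'n) \<Rightarrow> 'k set \<Rightarrow> 'k set \<Rightarrow> real ^ 'n \<Rightarrow> ('k \<Rightarrow> 'n::finite laurent) \<Rightarrow> bool" where
  "good_at a I J v f \<longleftrightarrow> (\<forall>i. posdir v (f i)) \<and> dominant I (Ov a v \<union> J) v f"

lemma good_at_scaleR: "s > 0 \<Longrightarrow> good_at a I J (s *\<^sub>R v) f \<longleftrightarrow> good_at a I J v f"
  by (simp add: good_at_def posdir_scaleR dominant_scaleR Ov_scaleR)

text \<open>Near \<open>v\<close> all strict \<open>v\<close>-inequalities between keys persist, so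
  only ties in the \<open>v\<close>-degree remain open. They are decided by
  \<open>w = v' - v\<close>, and this is where the hypothesis on the initial forms enters. The index
  it provides is admissible at \<open>v'\<close>, since \<open>Ov a w\<close> lies in
  \<open>Ov a v \<union> Ov a v'\<close> and \<open>Ov a v\<close> lies in
  \<open>Ov a v'\<close>.\<close>

lemma eventually_good_at:
  fixes f :: "'k::finite \<Rightarrow> 'n::finite laurent" and v :: "real ^ 'n"
  assumes v: "v \<noteq> 0"
    and pos: "\<And>i. posdir v (f i)"
    and dom: "\<And>w. w \<noteq> 0 \<Longrightarrow> dominant (Mv v I f) (Ov a w \<union> (Ov a v \<union> J)) w (\<lambda>i. initv v (f i))"
  shows "eventually (\<lambda>v'. good_at a I J v' f) (nhds v)"
proof -
  let ?E = "\<Union>i. Poly_Mapping.keys (f i)"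
  have "eventually (\<lambda>v'. \<forall>b\<in>?E. \<forall>b'\<in>?E. vdot v b < vdot v b' \<longrightarrow> vdot v' b < vdot v' b') (nhds v)"
    by (rule eventually_order_preserved) simp
  with eventually_Ov_mono[of a v] show ?thesis
  proof eventually_elim
    case (elim v')
    have order: "vdot v' b < vdot v' b'"
      if "b \<in> Poly_Mapping.keys (f i)" "b' \<in> Poly_Mapping.keys (f i')" "vdot v b < vdot v b'" for b b' i i'
    proof -
      have "b \<in> ?E" "b' \<in> ?E" using that by auto
      with elim(2) that(3) show ?thesis by blast
    qed
    have "posdir v' (f i)" for i
      unfolding posdir_def
    proof (intro conjI allI impI)
      show "f i \<noteq> 0" using pos by (simp add: posdir_def)
      fix b assume neg: "Poly_Mapping.lookup (f i) b < 0"
      then obtain b' where "b' \<in> Poly_Mapping.keys (f i)" "vdot v b < vdot v b'"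
        using pos by (auto simp: posdir_def)
      moreover have "b \<in> Poly_Mapping.keys (f i)" using neg by (simp add: in_keys_iff)
      ultimately show "\<exists>b'\<in>Poly_Mapping.keys (f i). vdot v' b < vdot v' b'"
        using order by blast
    qed
    moreover have "dominant I (Ov a v' \<union> J) v' f"
    proof -
      \<comment> \<open>For \<open>v' = v\<close> the difference vanishes, while \<open>dom\<close>
        asks for a nonzero direction; then \<open>w = v\<close> is taken, with weight
        \<open>s = 0\<close> below.\<close>
      define w where "w = (if v' = v then v else v' - v)"
      have "w \<noteq> 0" using v by (simp add: w_def)
      from dom[OF this] obtain i0 where i0: "i0 \<in> Mv v I f" "i0 \<in> Ov a w \<union> (Ov a v \<union> J)"
        and top: "\<And>i b. i \<in> Mv v I f \<Longrightarrow> b \<in> Poly_Mapping.keys (initv v (f i)) \<Longrightarrow>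
          \<exists>b0\<in>Poly_Mapping.keys (initv v (f i0)). vdot w b \<le> vdot w b0"
        by (auto simp: dominant_def)
      have v': "\<exists>s \<ge> 0. \<forall>b. vdot v' b = vdot v b + s * vdot w b"
      proof (cases "v' = v")
        case False
        then have "v' = v + w" by (simp add: w_def)
        then show ?thesis by (intro exI[of _ 1]) (simp add: vdot_add_left)
      qed (auto intro!: exI[of _ 0])
      then obtain s where s: "s \<ge> 0" and v'_eq: "\<And>b. vdot v' b = vdot v b + s * vdot w b"
        by blast
      have "Ov a w \<subseteq> Ov a v \<union> Ov a v'"
        by (cases "v' = v") (auto simp: Ov_def w_def vdot_eq_inner inner_diff_left)
      then have "i0 \<in> I \<inter> (Ov a v' \<union> J)"
        using i0 elim(1) by (auto simp: mem_Mv_iff)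
      moreover have "\<exists>b0\<in>Poly_Mapping.keys (f i0). vdot v' b \<le> vdot v' b0"
        if i: "i \<in> I" and b: "b \<in> Poly_Mapping.keys (f i)" for i b
      proof -
        have "f i0 \<noteq> 0" using pos by (auto simp: posdir_def)
        then obtain b1 where b1: "b1 \<in> Poly_Mapping.keys (f i0)"
            "\<forall>b'\<in>Poly_Mapping.keys (f i0). vdot v b' \<le> vdot v b1"
          using ex_top_key by blast
        have max: "\<And>i' b'. i' \<in> I \<Longrightarrow> b' \<in> Poly_Mapping.keys (f i') \<Longrightarrow> vdot v b' \<le> vdot v b1"
          using i0(1) b1(2) by (meson degv_le_iff mem_Mv_iff order_trans)
        show ?thesis
        proof (cases "vdot v b < vdot v b1")
          case True
          then show ?thesis
            using order[OF b b1(1)] b1(1) by (intro bexI[of _ b1]) simp_all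
        next
          case False
          with max[OF i b] have eq: "vdot v b = vdot v b1" by simp
          then have "b \<in> Poly_Mapping.keys (initv v (f i))"
            using b max[OF i] by (simp add: keys_initv)
          moreover have "i \<in> Mv v I f"
            using i b eq max by (metis degv_le_iff mem_Mv_iff)
          ultimately obtain b0 where b0: "b0 \<in> Poly_Mapping.keys (initv v (f i0))"
              "vdot w b \<le> vdot w b0"
            using top by blast
          then have "vdot v b0 = vdot v b1" "b0 \<in> Poly_Mapping.keys (f i0)"
            using b1 by (auto simp: keys_initv intro: antisym)
          with b0 eq s show ?thesis
            by (intro bexI[of _ b0]) (auto simp: v'_eq mult_left_mono)
        qed
      qed
      ultimately show ?thesis unfolding dominant_def by blast
    qed
    ultimately show ?case by (simp add: good_at_def)
  qed
qed

text \<open>Necessity of (b): the global condition is read off at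
  \<open>v + \<epsilon> *\<^sub>R w\<close> for a single small \<open>\<epsilon>\<close> depending
  on \<open>w\<close>. An \<open>a i\<close> orthogonal to both \<open>v\<close> and
  \<open>w\<close> is orthogonal to this vector, so the index found there is admissible.\<close>

lemma dominant_initv:
  fixes f :: "'k::finite \<Rightarrow> 'n::finite laurent" and v w :: "real ^ 'n"
  assumes v: "v \<noteq> 0" and nz: "\<And>i. f i \<noteq> 0"
    and dom: "\<And>v'. v' \<noteq> 0 \<Longrightarrow> dominant I (Ov a v' \<union> J) v' f"
  shows "dominant (Mv v I f) (Ov a w \<union> (Ov a v \<union> J)) w (\<lambda>i. initv v (f i))"
proof -
  let ?E = "\<Union>i. Poly_Mapping.keys (f i)"
  have lim: "((\<lambda>\<epsilon>. v + \<epsilon> *\<^sub>R w) \<longlongrightarrow> v) (at_right 0)"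
    by (auto intro!: tendsto_eq_intros)
  have "eventually (\<lambda>v'. v' \<noteq> 0 \<and>
      (\<forall>b\<in>?E. \<forall>b'\<in>?E. vdot v b < vdot v b' \<longrightarrow> vdot v' b < vdot v' b')) (nhds v)"
    using v by (intro eventually_conj eventually_order_preserved t1_space_nhds) auto
  then have "eventually (\<lambda>\<epsilon>. v + \<epsilon> *\<^sub>R w \<noteq> 0 \<and>
      (\<forall>b\<in>?E. \<forall>b'\<in>?E. vdot v b < vdot v b' \<longrightarrow> vdot (v + \<epsilon> *\<^sub>R w) b < vdot (v + \<epsilon> *\<^sub>R w) b'))
      (at_right 0)"
    using lim by (rule eventually_compose_filterlim)
  then have "eventually (\<lambda>\<epsilon>. \<epsilon> > 0 \<and> v + \<epsilon> *\<^sub>R w \<noteq> 0 \<and>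
      (\<forall>b\<in>?E. \<forall>b'\<in>?E. vdot v b < vdot v b' \<longrightarrow> vdot (v + \<epsilon> *\<^sub>R w) b < vdot (v + \<epsilon> *\<^sub>R w) b'))
      (at_right 0)"
    by (rule eventually_conj[OF eventually_at_right_less])
  then obtain \<epsilon> where \<epsilon>: "\<epsilon> > 0" "v + \<epsilon> *\<^sub>R w \<noteq> 0"
    and order': "\<forall>b\<in>?E. \<forall>b'\<in>?E. vdot v b < vdot v b' \<longrightarrow> vdot (v + \<epsilon> *\<^sub>R w) b < vdot (v + \<epsilon> *\<^sub>R w) b'"
    by (auto dest: eventually_happens)
  define v' where "v' = v + \<epsilon> *\<^sub>R w"
  have v'_eq: "vdot v' b = vdot v b + \<epsilon> * vdot w b" for b
    by (simp add: v'_def vdot_add_left vdot_scaleR_left)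
  have order: "vdot v' b < vdot v' b'"
    if "b \<in> Poly_Mapping.keys (f i)" "b' \<in> Poly_Mapping.keys (f i')" "vdot v b < vdot v b'" for b b' i i'
    using that order' unfolding v'_def by blast
  obtain i0 where i0: "i0 \<in> I" "i0 \<in> Ov a v' \<union> J"
    and top: "\<And>i b. i \<in> I \<Longrightarrow> b \<in> Poly_Mapping.keys (f i) \<Longrightarrow>
      \<exists>b0\<in>Poly_Mapping.keys (f i0). vdot v' b \<le> vdot v' b0"
    using dom[of v'] \<epsilon> unfolding v'_def dominant_def by blast
  \<comment> \<open>If \<open>b0\<close> had smaller \<open>v\<close>-degree than \<open>b\<close>,
    \<open>order\<close> would make its \<open>v'\<close>-degree smaller too; hence
    \<open>b0\<close> is at least as high in both directions.\<close>
  have mono: "\<exists>b0\<in>Poly_Mapping.keys (f i0). vdot v b \<le> vdot v b0 \<and> vdot v' b \<le> vdot v' b0"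
    if "i \<in> I" "b \<in> Poly_Mapping.keys (f i)" for i b
    using top[OF that] order that(2) by (meson not_le)
  have "i0 \<in> Ov a w \<union> (Ov a v \<union> J)"
    using i0(2) by (auto simp: Ov_def v'_eq)
  moreover have "i0 \<in> Mv v I f"
    using i0(1) mono by (fastforce simp: mem_Mv_iff degv_le_iff)
  moreover have "\<exists>b0\<in>Poly_Mapping.keys (initv v (f i0)). vdot w b \<le> vdot w b0"
    if i: "i \<in> Mv v I f" and b: "b \<in> Poly_Mapping.keys (initv v (f i))" for i b
  proof -
    from b have b': "b \<in> Poly_Mapping.keys (f i)" and
      bmax: "\<And>b'. b' \<in> Poly_Mapping.keys (f i) \<Longrightarrow> vdot v b' \<le> vdot v b"
      by (auto simp: keys_initv)
    have bmax0: "vdot v b' \<le> vdot v b" if "b' \<in> Poly_Mapping.keys (f i0)" for b'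
      using i i0(1) bmax that by (meson degv_le_iff mem_Mv_iff order_trans)
    obtain b0 where b0: "b0 \<in> Poly_Mapping.keys (f i0)" "vdot v b \<le> vdot v b0" "vdot v' b \<le> vdot v' b0"
      using mono[OF _ b'] i by (auto simp: mem_Mv_iff)
    then have "vdot v b = vdot v b0" using bmax0 by (intro antisym) auto
    moreover from this have "b0 \<in> Poly_Mapping.keys (initv v (f i0))"
      using b0 bmax0 by (auto simp: keys_initv)
    ultimately show ?thesis using b0(3) \<epsilon>(1) by (auto simp: v'_eq)
  qed
  ultimately show ?thesis unfolding dominant_def by blast
qed

section \<open>Gluing\<close>

lemma is_submodule_sum:
  assumes M: "is_submodule M" and "finite S" "\<And>j. j \<in> S \<Longrightarrow> q j \<in> M"
  shows "(\<lambda>i. \<Sum>j\<in>S. G j * q j i) \<in> M"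
  using assms(2,3)
proof (induction S rule: finite_induct)
  case empty
  then show ?case using M by (simp add: is_submodule_def)
next
  case (insert j S)
  then have "(\<lambda>i. \<Sum>j\<in>S. G j * q j i) \<in> M" "(\<lambda>i. G j * q j i) \<in> M"
    using M by (auto simp: is_submodule_def)
  then have "(\<lambda>i. G j * q j i + (\<Sum>j\<in>S. G j * q j i)) \<in> M"
    using M by (auto simp: is_submodule_def)
  then show ?case using insert by simp
qed

lemma lookup_glue:
  "Poly_Mapping.lookup (\<Sum>j\<in>S. G j * q j) x =
    (\<Sum>j\<in>S. \<Sum>c\<in>Poly_Mapping.keys (q j). Poly_Mapping.lookup (G j) (x - c) * Poly_Mapping.lookup (q j) c)"
  for q :: "'j \<Rightarrow> 'n::finite laurent"
  by (simp add: lookup_sum lookup_times_sum)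

lemma keys_glueE:
  fixes q :: "'j \<Rightarrow> 'n::finite laurent"
  assumes "x \<in> Poly_Mapping.keys (\<Sum>j\<in>S. G j * q j)"
  obtains j b c where "j \<in> S" "b \<in> Poly_Mapping.keys (G j)" "c \<in> Poly_Mapping.keys (q j)" "x = b + c"
proof -
  from assms have "(\<Sum>j\<in>S. \<Sum>c\<in>Poly_Mapping.keys (q j).
      Poly_Mapping.lookup (G j) (x - c) * Poly_Mapping.lookup (q j) c) \<noteq> 0"
    by (simp add: in_keys_iff lookup_glue)
  then obtain j where j: "j \<in> S" "(\<Sum>c\<in>Poly_Mapping.keys (q j).
      Poly_Mapping.lookup (G j) (x - c) * Poly_Mapping.lookup (q j) c) \<noteq> 0"
    by (rule sum.not_neutral_contains_not_neutral)
  from j(2) obtain c where "c \<in> Poly_Mapping.keys (q j)"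
      "Poly_Mapping.lookup (G j) (x - c) * Poly_Mapping.lookup (q j) c \<noteq> 0"
    by (rule sum.not_neutral_contains_not_neutral)
  then show thesis
    using j by (intro that[of j "x - c" c]) (auto simp: in_keys_iff)
qed

text \<open>There is no cancellation at an \<open>x\<close> whose \<open>v\<close>-degree no product
  exceeds: every pair contributing to \<open>x\<close> involves a \<open>v\<close>-top key of some
  \<open>q j\<close>, whose coefficient is positive by \<open>posdir\<close>.\<close>

lemma glue_top_coeff:
  fixes q :: "'j \<Rightarrow> 'n::finite laurent" and v :: "real ^ 'n"
  assumes "finite S"
    and nonneg: "\<And>j b. j \<in> S \<Longrightarrow> Poly_Mapping.lookup (G j) b \<ge> 0"
    and max: "\<And>j b c. j \<in> S \<Longrightarrow> b \<in> Poly_Mapping.keys (G j) \<Longrightarrow> c \<in> Poly_Mapping.keys (q j) \<Longrightarrow>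
      vdot v (b + c) \<le> vdot v x"
    and top: "\<And>j b c. j \<in> S \<Longrightarrow> b \<in> Poly_Mapping.keys (G j) \<Longrightarrow> c \<in> Poly_Mapping.keys (q j) \<Longrightarrow>
      vdot v (b + c) = vdot v x \<Longrightarrow> posdir v (q j)"
  shows "Poly_Mapping.lookup (\<Sum>j\<in>S. G j * q j) x \<ge> 0"
    and "j \<in> S \<Longrightarrow> b \<in> Poly_Mapping.keys (G j) \<Longrightarrow> c \<in> Poly_Mapping.keys (q j) \<Longrightarrow> x = b + c \<Longrightarrow>
      x \<in> Poly_Mapping.keys (\<Sum>j\<in>S. G j * q j)"
proof -
  have coeff_pos: "Poly_Mapping.lookup (q j) c > 0"
    if "j \<in> S" "c \<in> Poly_Mapping.keys (q j)" "x - c \<in> Poly_Mapping.keys (G j)" for j c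
  proof (rule posdir_top_key_pos)
    show "posdir v (q j)" using top[OF that(1,3,2)] by simp
    show "\<forall>c'\<in>Poly_Mapping.keys (q j). vdot v c' \<le> vdot v c"
      using max[OF that(1,3)] vdot_add_right[of v "x - c"] by (metis add_le_cancel_left diff_add_cancel)
  qed (use that in auto)
  have term_nonneg: "Poly_Mapping.lookup (G j) (x - c) * Poly_Mapping.lookup (q j) c \<ge> 0"
    if "j \<in> S" "c \<in> Poly_Mapping.keys (q j)" for j c
    using coeff_pos[OF that] nonneg[OF that(1), of "x - c"]
    by (cases "Poly_Mapping.lookup (G j) (x - c) = 0") (auto simp: in_keys_iff)
  show "Poly_Mapping.lookup (\<Sum>j\<in>S. G j * q j) x \<ge> 0"
    unfolding lookup_glue by (intro sum_nonneg term_nonneg)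
  assume j: "j \<in> S" "b \<in> Poly_Mapping.keys (G j)" "c \<in> Poly_Mapping.keys (q j)" "x = b + c"
  have "Poly_Mapping.lookup (G j) (x - c) * Poly_Mapping.lookup (q j) c > 0"
    using j coeff_pos[OF j(1,3)] nonneg[OF j(1), of b] by (auto simp: in_keys_iff order_less_le)
  then have "(\<Sum>c\<in>Poly_Mapping.keys (q j). Poly_Mapping.lookup (G j) (x - c) * Poly_Mapping.lookup (q j) c) > 0"
    using j by (intro sum_pos2[of _ c] term_nonneg) auto
  then have "Poly_Mapping.lookup (\<Sum>j\<in>S. G j * q j) x > 0"
    unfolding lookup_glue using j \<open>finite S\<close> by (intro sum_pos2[of _ j] sum_nonneg term_nonneg) auto
  then show "x \<in> Poly_Mapping.keys (\<Sum>j\<in>S. G j * q j)" by (simp add: in_keys_iff)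
qed

text \<open>Multipliers of summands that are not good at \<open>v\<close> are so small in direction \<open>v\<close> that these
  summands cannot reach the top \<open>v\<close>-degree of any component.\<close>

lemma good_at_glue:
  fixes q :: "'j \<Rightarrow> 'k::finite \<Rightarrow> 'n::finite laurent" and v :: "real ^ 'n"
  assumes fin: "finite S"
    and nonneg: "\<And>j b. j \<in> S \<Longrightarrow> Poly_Mapping.lookup (G j) b \<ge> 0"
    and bound: "\<And>j i c. j \<in> S \<Longrightarrow> c \<in> Poly_Mapping.keys (q j i) \<Longrightarrow> \<bar>vdot v c\<bar> \<le> D"
    and S': "S' \<subseteq> S" "\<And>j. j \<in> S' \<Longrightarrow> good_at a I J v (q j)"
    and nz: "l \<in> S'" "G l \<noteq> 0"
    and bad: "\<And>j b. j \<in> S - S' \<Longrightarrow> b \<in> Poly_Mapping.keys (G j) \<Longrightarrow>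
      \<exists>j'\<in>S'. \<exists>b'\<in>Poly_Mapping.keys (G j'). vdot v b + 2 * D < vdot v b'"
  shows "good_at a I J v (\<lambda>i. \<Sum>j\<in>S. G j * q j i)"
proof -
  define T where "T i = (SIGMA j:S. Poly_Mapping.keys (G j) \<times> Poly_Mapping.keys (q j i))" for i
  define wt where "wt = (\<lambda>(j :: 'j, b, c). vdot v (b + c))"
  have finT: "finite (T i)" for i using fin by (auto simp: T_def)
  have q_nz: "q j i \<noteq> 0" if "j \<in> S'" for j i
    using S'(2)[OF that] by (simp add: good_at_def posdir_def)
  have neT: "T i \<noteq> {}" for i
  proof -
    have "Poly_Mapping.keys (G l) \<noteq> {}" "Poly_Mapping.keys (q l i) \<noteq> {}" "l \<in> S"
      using nz q_nz[of l i] S'(1) by auto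
    then show ?thesis unfolding T_def by blast
  qed
  \<comment> \<open>Switching to the better multiplier also changes the key of the summand, which
    loses at most \<open>2 * D\<close>; the margin in \<open>bad\<close> pays for this.\<close>
  have better: "\<exists>j'\<in>S'. \<exists>b' c'. (j', b', c') \<in> T i \<and> wt (j, b, c) < wt (j', b', c')"
    if t: "(j, b, c) \<in> T i" and j: "j \<notin> S'" for i j b c
  proof -
    from t j obtain j' b' where j': "j' \<in> S'" "b' \<in> Poly_Mapping.keys (G j')" "vdot v b + 2 * D < vdot v b'"
      using bad[of j b] by (auto simp: T_def)
    then obtain c' where c': "c' \<in> Poly_Mapping.keys (q j' i)"
      using q_nz[of j' i] by (meson ex_top_key)
    have "\<bar>vdot v c\<bar> \<le> D" "\<bar>vdot v c'\<bar> \<le> D"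
      using bound t c' j'(1) S'(1) by (auto simp: T_def)
    then have "wt (j, b, c) < wt (j', b', c')"
      using j'(3) by (simp add: wt_def vdot_add_right)
    then show ?thesis using j' c' S'(1) by (auto simp: T_def)
  qed
  have top_coeff:
    "Poly_Mapping.lookup (\<Sum>j\<in>S. G j * q j i) x \<ge> 0"
    "\<And>j b c. (j, b, c) \<in> T i \<Longrightarrow> x = b + c \<Longrightarrow> x \<in> Poly_Mapping.keys (\<Sum>j\<in>S. G j * q j i)"
    if max: "\<And>t. t \<in> T i \<Longrightarrow> wt t \<le> vdot v x" for i x
  proof -
    have 1: "vdot v (b + c) \<le> vdot v x"
      if "j \<in> S" "b \<in> Poly_Mapping.keys (G j)" "c \<in> Poly_Mapping.keys (q j i)" for j b c
      using max[of "(j, b, c)"] that by (auto simp: T_def wt_def)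
    have 2: "posdir v (q j i)"
      if "j \<in> S" "b \<in> Poly_Mapping.keys (G j)" "c \<in> Poly_Mapping.keys (q j i)"
        "vdot v (b + c) = vdot v x" for j b c
    proof -
      have "j \<in> S'"
      proof (rule ccontr)
        assume "j \<notin> S'"
        moreover have "(j, b, c) \<in> T i" using that by (simp add: T_def)
        ultimately obtain t where "t \<in> T i" "wt (j, b, c) < wt t"
          using better by blast
        then show False using max[of t] that(4) by (simp add: wt_def)
      qed
      then show ?thesis using S'(2) by (simp add: good_at_def)
    qed
    show "Poly_Mapping.lookup (\<Sum>j\<in>S. G j * q j i) x \<ge> 0"
      by (rule glue_top_coeff(1)[OF fin nonneg 1 2])
    show "x \<in> Poly_Mapping.keys (\<Sum>j\<in>S. G j * q j i)" if "(j, b, c) \<in> T i" "x = b + c" for j b c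
      by (rule glue_top_coeff(2)[where j = j and b = b and c = c], rule fin, erule nonneg,
          erule (2) 1, erule (3) 2) (use that in \<open>auto simp: T_def\<close>)
  qed
  have keysE: "\<exists>t\<in>T i. vdot v x = wt t" if "x \<in> Poly_Mapping.keys (\<Sum>j\<in>S. G j * q j i)" for i x
    using that by (rule keys_glueE) (auto simp: T_def wt_def intro!: bexI[rotated])
  have ex_max: "\<exists>t\<in>U. \<forall>t'\<in>U. wt t' \<le> wt t" if "finite U" "U \<noteq> {}" for U
  proof -
    have "Max (wt ` U) \<in> wt ` U" using that by (intro Max_in) auto
    then show ?thesis using that by (metis Max_ge finite_imageI imageE imageI)
  qed
  have "posdir v (\<Sum>j\<in>S. G j * q j i)" for i
  proof -
    from ex_max[OF finT neT] obtain j b c where t: "(j, b, c) \<in> T i" "\<And>t'. t' \<in> T i \<Longrightarrow> wt t' \<le> vdot v (b + c)"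
      unfolding wt_def by fastforce
    note key = top_coeff(2)[OF t(2) t(1) refl]
    moreover have "vdot v x < vdot v (b + c)"
      if neg: "Poly_Mapping.lookup (\<Sum>j\<in>S. G j * q j i) x < 0" for x
    proof (rule ccontr)
      assume "\<not> vdot v x < vdot v (b + c)"
      then have "\<And>t. t \<in> T i \<Longrightarrow> wt t \<le> vdot v x" using t(2) by force
      from top_coeff(1)[of i x, OF this] neg show False by simp
    qed
    ultimately show ?thesis unfolding posdir_def by auto
  qed
  moreover have "dominant I (Ov a v \<union> J) v (\<lambda>i. \<Sum>j\<in>S. G j * q j i)"
  proof -
    have "I \<noteq> {}" using S'(2)[OF nz(1)] by (auto simp: good_at_def dominant_def)
    then have "finite (\<Union>i\<in>I. T i)" "(\<Union>i\<in>I. T i) \<noteq> {}" using finT neT by auto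
    from ex_max[OF this] obtain t where "t \<in> (\<Union>i\<in>I. T i)" "\<forall>t'\<in>(\<Union>i\<in>I. T i). wt t' \<le> wt t"
      by blast
    then obtain i j b c where i: "i \<in> I" and t: "(j, b, c) \<in> T i"
      and max: "\<And>i' t'. i' \<in> I \<Longrightarrow> t' \<in> T i' \<Longrightarrow> wt t' \<le> wt (j, b, c)"
      by (cases t) auto
    have "j \<in> S'" using better[OF t] max[OF i] by (meson not_le)
    \<comment> \<open>All components share the multiplier \<open>G j\<close>. Keeping
      \<open>b\<close> and replacing \<open>c\<close> by a key \<open>c0\<close> of the dominant
      component of \<open>q j\<close> carries the maximal triple over to \<open>i0\<close>.\<close>
    then obtain i0 c0 where i0: "i0 \<in> I" "i0 \<in> Ov a v \<union> J"
      and c0: "c0 \<in> Poly_Mapping.keys (q j i0)" "vdot v c \<le> vdot v c0"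
      using S'(2)[of j] i t unfolding good_at_def dominant_def T_def by blast
    have t0: "(j, b, c0) \<in> T i0" using t c0 by (auto simp: T_def)
    have le: "wt (j, b, c) \<le> vdot v (b + c0)" using c0 by (simp add: wt_def vdot_add_right)
    then have "wt t' \<le> vdot v (b + c0)" if "t' \<in> T i'" "i' \<in> I" for t' i'
      using max[OF that(2,1)] by linarith
    note max0 = this
    have "b + c0 \<in> Poly_Mapping.keys (\<Sum>j\<in>S. G j * q j i0)"
      using top_coeff(2)[OF max0[OF _ i0(1)] t0] by blast
    moreover have "vdot v x \<le> vdot v (b + c0)"
      if "i' \<in> I" "x \<in> Poly_Mapping.keys (\<Sum>j\<in>S. G j * q j i')" for i' x
      using keysE[OF that(2)] max0[OF _ that(1)] by auto
    ultimately show ?thesis using i0 unfolding dominant_def by blast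
  qed
  ultimately show ?thesis by (simp add: good_at_def)
qed

text \<open>For unit vectors v.x = 1 - |x - v|^2/2, so monomials with exponents near
  \<open>\<rho> *\<^sub>R x\<close> rank the net points by distance from \<open>v\<close>, up to
  rounding. Points closer than the Lebesgue number \<open>e\<close> carry elements good at
  \<open>v\<close>; the others lose by a margin proportional to \<open>\<rho>\<close>.\<close>

lemma ex_good_everywhere:
  fixes M :: "('k::finite \<Rightarrow> 'n::finite laurent) set" and a :: "'k \<Rightarrow> int ^ 'n"
  assumes M: "is_submodule M"
    and loc: "\<And>v :: real ^ 'n. v \<noteq> 0 \<Longrightarrow> \<exists>h\<in>M. eventually (\<lambda>v'. good_at a I J v' h) (nhds v)"
  shows "\<exists>f\<in>M. \<forall>v. v \<noteq> 0 \<longrightarrow> good_at a I J v f"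
proof -
  let ?S = "sphere 0 1 :: (real ^ 'n) set"
  let ?C = "{U. open U \<and> (\<exists>h\<in>M. \<forall>v\<in>U. good_at a I J v h)}"
  have "?S \<subseteq> \<Union>?C"
  proof
    fix v :: "real ^ 'n"
    assume "v \<in> ?S"
    then have "v \<noteq> 0" by auto
    then obtain h where h: "h \<in> M" "eventually (\<lambda>v'. good_at a I J v' h) (nhds v)"
      using loc by blast
    then obtain U where "open U" "v \<in> U" "\<forall>v'\<in>U. good_at a I J v' h"
      by (auto simp: eventually_nhds)
    with h(1) show "v \<in> \<Union>?C" by blast
  qed
  then obtain e where e: "e > 0" and ball: "\<And>x. x \<in> ?S \<Longrightarrow> \<exists>U\<in>?C. ball x e \<subseteq> U"
    by (rule Heine_Borel_lemma[OF compact_sphere]) auto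
  from ball have "\<exists>h\<in>M. \<forall>v\<in>ball x e. good_at a I J v h" if "x \<in> ?S" for x
    using that by (fastforce dest!: ball)
  then obtain h where hM: "\<And>x. x \<in> ?S \<Longrightarrow> h x \<in> M"
    and hgood: "\<And>x v. x \<in> ?S \<Longrightarrow> dist x v < e \<Longrightarrow> good_at a I J v (h x)"
    by (metis mem_ball)
  \<comment> \<open>Mesh \<open>e / 2\<close> and not \<open>e\<close>: some net point must be
    definitely closer to \<open>v\<close> than all points whose element may fail at
    \<open>v\<close>.\<close>
  obtain X where X: "X \<subseteq> ?S" "finite X" "?S \<subseteq> (\<Union>x\<in>X. ball x (e / 2))"
  proof (rule compactE_image[OF compact_sphere[of "0 :: real ^ 'n" 1], of ?S "\<lambda>x. ball x (e / 2)"])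
    show "?S \<subseteq> (\<Union>x\<in>?S. ball x (e / 2))" using e by auto
  qed auto
  let ?K = "\<Union>x\<in>X. \<Union>i. Poly_Mapping.keys (h x i)"
  define D where "D = Max (insert 0 ((\<lambda>c. norm (exponent_vec c)) ` ?K))"
  have D: "norm (exponent_vec c) \<le> D" if "x \<in> X" "c \<in> Poly_Mapping.keys (h x i)" for x i c
    unfolding D_def using that X(2) by (intro Max_ge) auto
  define C where "C = real CARD('n)"
  \<comment> \<open>Net points within \<open>e / 2\<close> of \<open>v\<close> and those at distance
    at least \<open>e\<close> differ in their inner product with \<open>v\<close> by at least e^2/2
    - e^2/8 = 3 e^2/8. The factor stretches this gap to two roundings (\<open>2 * C\<close>), the
    spread of the keys (\<open>2 * D\<close>), and 1 for strictness.\<close>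
  define \<rho> where "\<rho> = (2 * C + 2 * D + 1) * 8 / (3 * e\<^sup>2)"
  have "D \<ge> 0" unfolding D_def using X(2) by (intro Max_ge) auto
  then have "\<rho> > 0" using e by (simp add: \<rho>_def C_def)
  have \<rho>: "\<rho> * (3 * e\<^sup>2 / 8) = 2 * C + 2 * D + 1"
    using e by (simp add: \<rho>_def)
  define \<beta> where "\<beta> x = (SOME b. norm (exponent_vec b - \<rho> *\<^sub>R x) \<le> C)" for x :: "real ^ 'n"
  have \<beta>: "norm (exponent_vec (\<beta> x) - \<rho> *\<^sub>R x) \<le> C" for x
    unfolding \<beta>_def C_def by (rule someI_ex[OF exponent_near])
  define G :: "real ^ 'n \<Rightarrow> 'n laurent" where "G x = Poly_Mapping.single (\<beta> x) 1" for x
  define f where "f = (\<lambda>i. \<Sum>x\<in>X. G x * h x i)"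
  have "f \<in> M"
    unfolding f_def using M X(2) hM X(1) by (intro is_submodule_sum) auto
  have good: "good_at a I J v f" if v: "norm v = 1" for v
  proof -
    have near: "\<bar>vdot v (\<beta> x) - \<rho> * (v \<bullet> x)\<bar> \<le> C" for x
    proof -
      have "vdot v (\<beta> x) - \<rho> * (v \<bullet> x) = v \<bullet> (exponent_vec (\<beta> x) - \<rho> *\<^sub>R x)"
        by (simp add: vdot_eq_inner inner_diff_right)
      also have "\<bar>\<dots>\<bar> \<le> norm v * norm (exponent_vec (\<beta> x) - \<rho> *\<^sub>R x)"
        by (rule Cauchy_Schwarz_ineq2)
      finally show ?thesis using v \<beta>[of x] by simp
    qed
    have inner_dist: "v \<bullet> x = 1 - (dist x v)\<^sup>2 / 2" if "x \<in> ?S" for x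
      using that v by (simp add: dist_norm power2_norm_eq_inner inner_diff_left inner_diff_right
          inner_commute norm_eq_1 diff_divide_distrib)
    obtain x0 where x0: "x0 \<in> X" "dist x0 v < e / 2"
      using X(3) v by auto
    show ?thesis
      unfolding f_def
    proof (rule good_at_glue[where S' = "{x \<in> X. dist x v < e}" and D = D and l = x0])
      show "\<bar>vdot v c\<bar> \<le> D" if "x \<in> X" "c \<in> Poly_Mapping.keys (h x i)" for x i c
        using Cauchy_Schwarz_ineq2[of v "exponent_vec c"] D[OF that] v by (simp add: vdot_eq_inner)
      show "\<exists>x'\<in>{x \<in> X. dist x v < e}. \<exists>b'\<in>Poly_Mapping.keys (G x'). vdot v b + 2 * D < vdot v b'"
        if x: "x \<in> X - {x \<in> X. dist x v < e}" and b: "b \<in> Poly_Mapping.keys (G x)" for x b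
      proof -
        have "x \<in> ?S" "x0 \<in> ?S" using x x0 X(1) by auto
        have "e\<^sup>2 \<le> (dist x v)\<^sup>2" "(dist x0 v)\<^sup>2 \<le> (e / 2)\<^sup>2"
          using x x0 e by (auto intro!: power_mono)
        then have "v \<bullet> x0 - v \<bullet> x \<ge> 3 * e\<^sup>2 / 8"
          using inner_dist[OF \<open>x \<in> ?S\<close>] inner_dist[OF \<open>x0 \<in> ?S\<close>] by (simp add: power_divide)
        then have "\<rho> * (v \<bullet> x0 - v \<bullet> x) \<ge> \<rho> * (3 * e\<^sup>2 / 8)"
          using \<open>\<rho> > 0\<close> by (intro mult_left_mono) auto
        then have "vdot v (\<beta> x) + 2 * D < vdot v (\<beta> x0)"
          using near[of x] near[of x0] \<rho> by (simp add: right_diff_distrib)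
        then show ?thesis
          using b x0 e by (intro bexI[of _ x0] bexI[of _ "\<beta> x0"]) (auto simp: G_def)
      qed
      show "G x0 \<noteq> 0"
        unfolding G_def by (metis lookup_single_eq lookup_zero zero_neq_one)
    qed (use X x0 e hgood in \<open>auto simp: G_def lookup_single when_def\<close>)
  qed
  have "good_at a I J v f" if "v \<noteq> 0" for v
    using good[of "sgn v"] good_at_scaleR[of "norm v" a I J "sgn v" f] that
    by (simp add: norm_sgn sgn_div_norm)
  with \<open>f \<in> M\<close> show ?thesis by blast
qed

section \<open>Behaviour at infinity\<close>

text \<open>For an exponent \<open>c\<close> with negative coefficient, the sum over the keys of the
  positive parts of v.b - v.c is continuous, homogeneous and, by \<open>posdir\<close>, positive on
  the sphere. Its minimum there divided by the number of keys is a lower bound for the largest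
  summand.\<close>

lemma ex_uniform_gap:
  fixes f :: "'n::finite laurent"
  assumes pos: "\<And>v. v \<noteq> 0 \<Longrightarrow> posdir v f"
  shows "\<exists>\<delta>>0. \<forall>u c c'. Poly_Mapping.lookup f c < 0 \<longrightarrow> c' \<in> Poly_Mapping.keys f \<longrightarrow>
    (\<forall>b\<in>Poly_Mapping.keys f. vdot u b \<le> vdot u c') \<longrightarrow> \<delta> * norm u \<le> vdot u c' - vdot u c"
proof -
  let ?P = "\<lambda>\<delta> c. \<forall>u. \<forall>c'\<in>Poly_Mapping.keys f.
    (\<forall>b\<in>Poly_Mapping.keys f. vdot u b \<le> vdot u c') \<longrightarrow> \<delta> * norm u \<le> vdot u c' - vdot u c"
  have "eventually (\<lambda>\<delta>. ?P \<delta> c) (at_right 0)" if c: "Poly_Mapping.lookup f c < 0" for c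
  proof -
    define g where "g v = (\<Sum>b\<in>Poly_Mapping.keys f. max 0 (vdot v b - vdot v c))" for v
    have "continuous_on (sphere 0 1) g"
      unfolding g_def vdot_eq_inner by (intro continuous_intros)
    then obtain v0 where v0: "v0 \<in> sphere 0 1" "\<And>v. v \<in> sphere 0 1 \<Longrightarrow> g v0 \<le> g v"
      using continuous_attains_inf[OF compact_sphere, of "0 :: real ^ 'n" 1 g] by auto
    have "v0 \<noteq> 0" using v0(1) by auto
    then obtain b where "b \<in> Poly_Mapping.keys f" "vdot v0 c < vdot v0 b"
      using pos c unfolding posdir_def by blast
    then have "g v0 > 0" unfolding g_def by (intro sum_pos2[of _ b]) auto
    define m where "m = real (card (Poly_Mapping.keys f))"
    have "c \<in> Poly_Mapping.keys f" using c by (simp add: in_keys_iff)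
    then have "m > 0" unfolding m_def by (auto simp: card_gt_0_iff)
    have P: "?P (g v0 / m) c"
    proof (intro allI ballI impI)
      fix u c'
      assume c': "c' \<in> Poly_Mapping.keys f" "\<forall>b\<in>Poly_Mapping.keys f. vdot u b \<le> vdot u c'"
      show "g v0 / m * norm u \<le> vdot u c' - vdot u c"
      proof (cases "u = 0")
        case False
        have nonneg: "0 \<le> vdot u c' - vdot u c" using c' \<open>c \<in> _\<close> by simp
        have "g v0 \<le> g (sgn u)" using False by (intro v0(2)) (simp add: norm_sgn)
        then have "norm u * g v0 \<le> norm u * g (sgn u)"
          by (intro mult_left_mono) auto
        also have "\<dots> = g u"
        proof -
          have "vdot u x = norm u * vdot (sgn u) x" for x
            using False by (simp add: vdot_eq_inner sgn_div_norm)
          then show ?thesis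
            by (simp add: g_def sum_distrib_left max_mult_distrib_left right_diff_distrib)
        qed
        also have "g u \<le> (\<Sum>b\<in>Poly_Mapping.keys f. vdot u c' - vdot u c)"
          unfolding g_def using c'(2) nonneg by (intro sum_mono) auto
        also have "\<dots> = m * (vdot u c' - vdot u c)" by (simp add: m_def)
        finally show ?thesis using \<open>m > 0\<close> by (simp add: field_simps)
      qed (simp add: vdot_eq_inner)
    qed
    show ?thesis
    proof (rule eventually_at_rightI[of 0 "g v0 / m"])
      fix \<delta> assume \<delta>: "\<delta> \<in> {0<..<g v0 / m}"
      show "?P \<delta> c"
      proof (intro allI ballI impI)
        fix u c'
        assume "c' \<in> Poly_Mapping.keys f" "\<forall>b\<in>Poly_Mapping.keys f. vdot u b \<le> vdot u c'"
        with P have "g v0 / m * norm u \<le> vdot u c' - vdot u c" by blast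
        moreover have "\<delta> * norm u \<le> g v0 / m * norm u"
          using \<delta> by (intro mult_right_mono) auto
        ultimately show "\<delta> * norm u \<le> vdot u c' - vdot u c" by linarith
      qed
    qed (use \<open>g v0 > 0\<close> \<open>m > 0\<close> in simp)
  qed
  then have "eventually (\<lambda>\<delta>. \<forall>c\<in>{c. Poly_Mapping.lookup f c < 0}. ?P \<delta> c) (at_right 0)"
    by (intro eventually_ball_finite finite_subset[OF _ finite_keys[of f]])
      (auto simp: in_keys_iff)
  with eventually_at_right_less[of "0 :: real"]
  have "eventually (\<lambda>\<delta>. \<delta> > 0 \<and> (\<forall>c\<in>{c. Poly_Mapping.lookup f c < 0}. ?P \<delta> c)) (at_right 0)"
    by (rule eventually_conj)
  then have "\<exists>\<delta>. \<delta> > 0 \<and> (\<forall>c\<in>{c. Poly_Mapping.lookup f c < 0}. ?P \<delta> c)"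
    by (rule eventually_happens'[rotated]) simp
  then show ?thesis by blast
qed

text \<open>Only the term of \<open>c0\<close> is kept exactly: the remaining nonnegative
  coefficients contribute nothing negative, and each negative one costs at most its size times
  \<open>\<tau> * W c0\<close>.\<close>

lemma weighted_sum_ge:
  fixes f :: "'n::finite laurent"
  assumes c0: "c0 \<in> Poly_Mapping.keys f" and W: "\<And>c. W c \<ge> 0" and \<tau>: "\<tau> \<ge> (0 :: real)"
    and neg: "\<And>c. Poly_Mapping.lookup f c < 0 \<Longrightarrow> W c \<le> \<tau> * W c0"
  shows "W c0 * (Poly_Mapping.lookup f c0 - \<tau> * (\<Sum>c\<in>Poly_Mapping.keys f. \<bar>Poly_Mapping.lookup f c\<bar>))
    \<le> (\<Sum>c\<in>Poly_Mapping.keys f. Poly_Mapping.lookup f c * W c)"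
proof -
  let ?K = "Poly_Mapping.keys f" and ?l = "Poly_Mapping.lookup f"
  have "W c0 * \<tau> \<ge> 0" using W \<tau> by simp
  have "?l c * W c \<ge> - (W c0 * \<tau> * \<bar>?l c\<bar>)" for c
  proof (cases "?l c < 0")
    case True
    then have "?l c * (\<tau> * W c0) \<le> ?l c * W c"
      using neg by (intro mult_left_mono_neg) auto
    then show ?thesis using True by (simp add: mult_ac)
  next
    case False
    then show ?thesis using W[of c] \<open>W c0 * \<tau> \<ge> 0\<close>
      by (smt (verit) mult_nonneg_nonneg)
  qed
  then have "(\<Sum>c\<in>?K - {c0}. - (W c0 * \<tau> * \<bar>?l c\<bar>)) \<le> (\<Sum>c\<in>?K - {c0}. ?l c * W c)"
    by (intro sum_mono)
  moreover have "(\<Sum>c\<in>?K - {c0}. W c0 * \<tau> * \<bar>?l c\<bar>) \<le> (\<Sum>c\<in>?K. W c0 * \<tau> * \<bar>?l c\<bar>)"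
    using \<open>W c0 * \<tau> \<ge> 0\<close> by (intro sum_mono2) auto
  ultimately have "?l c0 * W c0 - (\<Sum>c\<in>?K. W c0 * \<tau> * \<bar>?l c\<bar>) \<le> (\<Sum>c\<in>?K. ?l c * W c)"
    using c0 by (simp add: sum.remove[of ?K c0 "\<lambda>c. ?l c * W c"] sum_negf)
  then show ?thesis
    by (simp add: right_diff_distrib mult_ac sum_distrib_left)
qed

text \<open>Abstract weights serve exponentials and truncated Gaussians alike. The decay asked of
  \<open>W\<close> uses only half of the gap \<open>\<delta> * norm u\<close>, which leaves room for
  the quadratic term of the Gaussian. Truncated weights may vanish, hence the weak conclusion beside
  the strict one.\<close>

lemma eventually_weighted_sum_pos:
  fixes f :: "'n::finite laurent"
  assumes pos: "\<And>v. v \<noteq> 0 \<Longrightarrow> posdir v f"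
  shows "\<exists>\<delta>>0. \<forall>\<^sub>F R in at_top. \<forall>u W. R \<le> norm u \<longrightarrow> (\<forall>c. 0 \<le> W c) \<longrightarrow>
    (\<forall>c\<in>Poly_Mapping.keys f. \<forall>c'\<in>Poly_Mapping.keys f.
      \<delta> * norm u \<le> vdot u c' - vdot u c \<longrightarrow> W c \<le> exp (- (\<delta> * norm u / 2)) * W c') \<longrightarrow>
    0 \<le> (\<Sum>c\<in>Poly_Mapping.keys f. Poly_Mapping.lookup f c * W c) \<and>
    ((\<forall>c. 0 < W c) \<longrightarrow> 0 < (\<Sum>c\<in>Poly_Mapping.keys f. Poly_Mapping.lookup f c * W c))"
proof -
  let ?K = "Poly_Mapping.keys f" and ?l = "Poly_Mapping.lookup f"
  obtain \<delta> where \<delta>: "\<delta> > 0" and gap: "\<And>u c c'. ?l c < 0 \<Longrightarrow> c' \<in> ?K \<Longrightarrow>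
      (\<forall>b\<in>?K. vdot u b \<le> vdot u c') \<Longrightarrow> \<delta> * norm u \<le> vdot u c' - vdot u c"
    using ex_uniform_gap[OF pos] by blast
  define A where "A = (\<Sum>c\<in>?K. \<bar>?l c\<bar>)"
  have "A \<ge> 0" by (simp add: A_def sum_nonneg)
  have lim: "((\<lambda>R. exp (- (\<delta> * R / 2)) * A) \<longlongrightarrow> 0) at_top"
  proof (rule tendsto_mult_left_zero)
    have "filterlim (\<lambda>R. \<delta> / 2 * R) at_top at_top"
      using \<delta> by (intro filterlim_tendsto_pos_mult_at_top[OF tendsto_const]) (auto simp: filterlim_ident)
    then have "filterlim (\<lambda>R. - (\<delta> * R / 2)) at_bot at_top"
      by (simp add: filterlim_uminus_at_bot)
    then show "((\<lambda>R. exp (- (\<delta> * R / 2))) \<longlongrightarrow> 0) at_top"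
      by (rule filterlim_compose[OF exp_at_bot])
  qed
  have "eventually (\<lambda>R. ?l c > 0 \<longrightarrow> exp (- (\<delta> * R / 2)) * A < ?l c) at_top" for c
    using order_tendstoD(2)[OF lim, of "?l c"] by (cases "?l c > 0") auto
  \<comment> \<open>The top key varies with \<open>u\<close>, so the threshold must suit every
    positive coefficient at once.\<close>
  then have "eventually (\<lambda>R. \<forall>c\<in>?K. ?l c > 0 \<longrightarrow> exp (- (\<delta> * R / 2)) * A < ?l c) at_top"
    by (intro eventually_ball_finite) auto
  with eventually_gt_at_top[of 0]
  have "\<forall>\<^sub>F R in at_top. \<forall>u W. R \<le> norm u \<longrightarrow> (\<forall>c. 0 \<le> W c) \<longrightarrow>
    (\<forall>c\<in>?K. \<forall>c'\<in>?K. \<delta> * norm u \<le> vdot u c' - vdot u c \<longrightarrow> W c \<le> exp (- (\<delta> * norm u / 2)) * W c') \<longrightarrow>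
    0 \<le> (\<Sum>c\<in>?K. ?l c * W c) \<and> ((\<forall>c. 0 < W c) \<longrightarrow> 0 < (\<Sum>c\<in>?K. ?l c * W c))"
  proof eventually_elim
    case (elim R)
    show ?case
    proof (intro allI impI)
      fix u W
      assume u: "R \<le> norm u" and W: "\<forall>c. (0 :: real) \<le> W c"
        and dec: "\<forall>c\<in>?K. \<forall>c'\<in>?K. \<delta> * norm u \<le> vdot u c' - vdot u c \<longrightarrow>
          W c \<le> exp (- (\<delta> * norm u / 2)) * W c'"
      let ?\<tau> = "exp (- (\<delta> * norm u / 2))"
      have "u \<noteq> 0" using u elim(1) by auto
      then have "posdir u f" by (rule pos)
      then obtain c0 where c0: "c0 \<in> ?K" "\<forall>b\<in>?K. vdot u b \<le> vdot u c0"
        using ex_top_key[of f u] by (auto simp: posdir_def)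
      then have "?l c0 > 0" using posdir_top_key_pos \<open>posdir u f\<close> by blast
      have "?\<tau> * A \<le> exp (- (\<delta> * R / 2)) * A"
        using u \<delta> \<open>A \<ge> 0\<close> by (intro mult_right_mono) auto
      also have "\<dots> < ?l c0" using elim(2) c0(1) \<open>?l c0 > 0\<close> by blast
      finally have lt: "?l c0 - ?\<tau> * A > 0" by simp
      have ge: "W c0 * (?l c0 - ?\<tau> * A) \<le> (\<Sum>c\<in>?K. ?l c * W c)"
        unfolding A_def
      proof (rule weighted_sum_ge)
        show "W c \<le> ?\<tau> * W c0" if "?l c < 0" for c
          using dec gap[OF that c0] c0(1) that by (simp add: in_keys_iff)
      qed (use c0 W in auto)
      show "0 \<le> (\<Sum>c\<in>?K. ?l c * W c) \<and> ((\<forall>c. 0 < W c) \<longrightarrow> 0 < (\<Sum>c\<in>?K. ?l c * W c))"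
      proof (intro conjI impI)
        show "0 \<le> (\<Sum>c\<in>?K. ?l c * W c)"
          using ge lt W by (meson less_imp_le mult_nonneg_nonneg order_trans)
        show "0 < (\<Sum>c\<in>?K. ?l c * W c)" if "\<forall>c. 0 < W c"
          using ge lt that by (meson mult_pos_pos less_le_trans)
      qed
    qed
  qed
  with \<delta> show ?thesis by blast
qed

lemma eventually_log_eval_pos:
  fixes f :: "'n::finite laurent"
  assumes pos: "\<And>v. v \<noteq> 0 \<Longrightarrow> posdir v f"
  shows "\<forall>\<^sub>F R in at_top. \<forall>u. R \<le> norm u \<longrightarrow> 0 < log_eval f u"
proof -
  from eventually_weighted_sum_pos[OF pos] obtain \<delta> where "\<delta> > 0" and
    ev: "\<forall>\<^sub>F R in at_top. \<forall>u W. R \<le> norm u \<longrightarrow> (\<forall>c. 0 \<le> W c) \<longrightarrow>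
    (\<forall>c\<in>Poly_Mapping.keys f. \<forall>c'\<in>Poly_Mapping.keys f.
      \<delta> * norm u \<le> vdot u c' - vdot u c \<longrightarrow> W c \<le> exp (- (\<delta> * norm u / 2)) * W c') \<longrightarrow>
    0 \<le> (\<Sum>c\<in>Poly_Mapping.keys f. Poly_Mapping.lookup f c * W c) \<and>
    ((\<forall>c. 0 < W c) \<longrightarrow> 0 < (\<Sum>c\<in>Poly_Mapping.keys f. Poly_Mapping.lookup f c * W c))"
    by blast
  from ev show ?thesis
  proof eventually_elim
    case (elim R)
    show ?case
    proof (intro allI impI)
      fix u :: "real ^ 'n" assume u: "R \<le> norm u"
      have "exp (u \<bullet> exponent_vec c) \<le> exp (- (\<delta> * norm u / 2)) * exp (u \<bullet> exponent_vec c')"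
        if "\<delta> * norm u \<le> vdot u c' - vdot u c" for c c'
      proof -
        have "0 \<le> \<delta> * norm u" using \<open>\<delta> > 0\<close> by simp
        with that show ?thesis by (simp add: vdot_eq_inner flip: exp_add)
      qed
      then show "0 < log_eval f u"
        unfolding log_eval_def
        using elim[rule_format, OF u, of "\<lambda>c. exp (u \<bullet> exponent_vec c)"] by simp
    qed
  qed
qed

section \<open>Truncated Gaussian weights far from the origin\<close>

definition trunc_gauss :: "real \<Rightarrow> real \<Rightarrow> real ^ 'n \<Rightarrow> real" where
  "trunc_gauss N s x = (if norm x \<le> s then exp (- ((norm x)\<^sup>2 / (2 * N))) else 0)"

text \<open>The weight is nonincreasing in the norm, and far out a key of clearly larger degree in
  direction \<open>x\<close> gives a shorter shift. If a dominated key survives the cut, so does the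
  key dominating it; the thresholds for \<open>R\<close> and \<open>N\<close> therefore do not
  depend on \<open>s\<close>.\<close>

lemma eventually_trunc_gauss_sum_nonneg:
  fixes f :: "'n::finite laurent"
  assumes pos: "\<And>v. v \<noteq> 0 \<Longrightarrow> posdir v f"
  shows "\<forall>\<^sub>F R in at_top. \<forall>\<^sub>F N in at_top. \<forall>x s. R * N \<le> norm x \<longrightarrow>
    0 \<le> (\<Sum>c\<in>Poly_Mapping.keys f. Poly_Mapping.lookup f c * trunc_gauss N s (x - exponent_vec c))"
proof -
  from eventually_weighted_sum_pos[OF pos] obtain \<delta> where \<delta>: "\<delta> > 0" and
    ev: "\<forall>\<^sub>F R in at_top. \<forall>u W. R \<le> norm u \<longrightarrow> (\<forall>c. 0 \<le> W c) \<longrightarrow>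
    (\<forall>c\<in>Poly_Mapping.keys f. \<forall>c'\<in>Poly_Mapping.keys f.
      \<delta> * norm u \<le> vdot u c' - vdot u c \<longrightarrow> W c \<le> exp (- (\<delta> * norm u / 2)) * W c') \<longrightarrow>
    0 \<le> (\<Sum>c\<in>Poly_Mapping.keys f. Poly_Mapping.lookup f c * W c) \<and>
    ((\<forall>c. 0 < W c) \<longrightarrow> 0 < (\<Sum>c\<in>Poly_Mapping.keys f. Poly_Mapping.lookup f c * W c))"
    by blast
  define C where "C = Max (insert 0 ((\<lambda>c. (norm (exponent_vec c))\<^sup>2) ` Poly_Mapping.keys f))"
  have C: "(norm (exponent_vec c))\<^sup>2 \<le> C" if "c \<in> Poly_Mapping.keys f" for c
    unfolding C_def using that by (intro Max_ge) auto
  from ev eventually_gt_at_top[of 0] show ?thesis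
  proof eventually_elim
    case (elim R)
    show ?case
      using eventually_gt_at_top[of 0] eventually_ge_at_top[of "C / (\<delta> * R)"]
    proof eventually_elim
      case N: (elim N)
      show ?case
      proof (intro allI impI)
        fix x :: "real ^ 'n" and s :: real
        assume x: "R * N \<le> norm x"
        define u where "u = x /\<^sub>R N"
        have xu: "x = N *\<^sub>R u" using N(1) by (simp add: u_def)
        have norm_u: "R \<le> norm u" using x N(1) by (simp add: u_def field_simps)
        let ?W = "\<lambda>c. trunc_gauss N s (x - exponent_vec c)"
        have dec: "?W c \<le> exp (- (\<delta> * norm u / 2)) * ?W c'"
          if c: "c \<in> Poly_Mapping.keys f" "c' \<in> Poly_Mapping.keys f" "\<delta> * norm u \<le> vdot u c' - vdot u c" for c c'
        proof -
          have exp: "(norm (x - exponent_vec b))\<^sup>2 = (norm x)\<^sup>2 - 2 * (N * vdot u b) + (norm (exponent_vec b))\<^sup>2" for b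
          proof -
            have "N * vdot u b = x \<bullet> exponent_vec b" by (simp add: vdot_eq_inner xu)
            then show ?thesis
              by (simp add: power2_norm_eq_inner inner_diff_left inner_diff_right inner_commute)
          qed
          have "N * (\<delta> * norm u) \<le> N * (vdot u c' - vdot u c)"
            using N(1) c(3) by (intro mult_left_mono) auto
          moreover have "C \<le> N * (\<delta> * norm u)"
          proof -
            have "C \<le> N * (\<delta> * R)" using N(2) elim(2) \<delta> by (simp add: field_simps)
            also have "\<dots> \<le> N * (\<delta> * norm u)"
              using N(1) norm_u \<delta> by (intro mult_left_mono) auto
            finally show ?thesis .
          qed
          \<comment> \<open>The squares differ by at least 2 N (u.c' - u.c) - |c'|^2. Half of the
            first term absorbs |c'|^2 <= \<open>C\<close> since \<open>N\<close> is large; the other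
            half, divided by \<open>2 * N\<close>, gives the exponent
            \<open>\<delta> * norm u / 2\<close>.\<close>
          ultimately have diff: "(norm (x - exponent_vec c'))\<^sup>2 + N * (\<delta> * norm u) \<le> (norm (x - exponent_vec c))\<^sup>2"
            using C[OF c(2)] zero_le_power2[of "norm (exponent_vec c)"]
            unfolding exp right_diff_distrib by linarith
          have "0 \<le> N * (\<delta> * norm u)" using N(1) \<delta> by simp
          then have "norm (x - exponent_vec c') \<le> norm (x - exponent_vec c)"
            by (intro power2_le_imp_le[OF _ norm_ge_zero]) (use diff in linarith)
          moreover have "\<delta> * norm u / 2 + (norm (x - exponent_vec c'))\<^sup>2 / (2 * N)
              \<le> (norm (x - exponent_vec c))\<^sup>2 / (2 * N)"
            using divide_right_mono[OF diff, of "2 * N"] N(1) by (simp add: add_divide_distrib)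
          ultimately show ?thesis
            by (simp add: trunc_gauss_def flip: exp_add)
        qed
        show "0 \<le> (\<Sum>c\<in>Poly_Mapping.keys f. Poly_Mapping.lookup f c * ?W c)"
          using elim(1)[rule_format, OF norm_u, of ?W] dec by (simp add: trunc_gauss_def)
      qed
    qed
  qed
qed

section \<open>Positivity on the positive orthant\<close>

text \<open>Radii are capped at 1 so that bumps centred in \<open>cball 0 R\<close> vanish from norm
  \<open>R + 1\<close> on.\<close>

lemma ex_finite_local_positive:
  fixes M :: "('k::finite \<Rightarrow> 'n::finite laurent) set"
  assumes loc: "\<And>u :: real ^ 'n. \<exists>g\<in>M. \<forall>i. log_eval (g i) u > 0"
  shows "\<exists>K g e. finite K \<and> K \<subseteq> cball 0 R \<and> cball 0 R \<subseteq> (\<Union>k\<in>K. ball k (e k)) \<and>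
    (\<forall>k. g k \<in> M \<and> e k \<le> 1 \<and> (\<forall>u i. dist k u < e k \<longrightarrow> log_eval (g k i) u > 0))"
proof -
  obtain g where g: "\<And>u. g u \<in> M" "\<And>u i. log_eval (g u i) u > 0"
    using loc by metis
  have "\<exists>\<epsilon>>0. \<epsilon> \<le> 1 \<and> (\<forall>u. dist k u < \<epsilon> \<longrightarrow> (\<forall>i. log_eval (g k i) u > 0))" for k
  proof -
    have "\<forall>\<^sub>F u in nhds k. log_eval (g k i) u > 0" for i
      using isCont_log_eval g(2) by (intro order_tendstoD(1)[of _ "log_eval (g k i) k"])
        (auto simp: isCont_def tendsto_at_iff_tendsto_nhds)
    then have "\<forall>\<^sub>F u in nhds k. \<forall>i. log_eval (g k i) u > 0"
      by (rule eventually_all_finite)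
    then obtain d where "d > 0" "\<And>u. dist u k < d \<Longrightarrow> \<forall>i. log_eval (g k i) u > 0"
      unfolding eventually_nhds_metric by blast
    then show ?thesis by (intro exI[of _ "min 1 d"]) (auto simp: dist_commute)
  qed
  then obtain e where e: "\<And>k. e k > 0" "\<And>k. e k \<le> 1"
    "\<And>k u i. dist k u < e k \<Longrightarrow> log_eval (g k i) u > 0"
    by metis
  obtain K where "K \<subseteq> cball 0 R" "finite K" "cball 0 R \<subseteq> (\<Union>k\<in>K. ball k (e k))"
  proof (rule compactE_image[OF compact_cball[of "0 :: real ^ 'n" R], of "cball 0 R" "\<lambda>k. ball k (e k)"])
    show "cball 0 R \<subseteq> (\<Union>k\<in>cball 0 R. ball k (e k))" using e(1) by force
  qed auto
  then show ?thesis
    using g(1) e(2,3) by (intro exI[of _ K] exI[of _ g] exI[of _ e]) simp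
qed

text \<open>Multiplying \<open>q\<^sub>j\<close> by \<open>\<Sum>\<^sub>b \<phi>\<^sub>j(b/N) exp(-|b|\<^sup>2/2N) X\<^sup>b\<close> makes the coefficient at \<open>b\<close> of the sum equal to
  \<open>exp(-|b|\<^sup>2/2N)\<close> times a perturbation, of order \<open>1/N\<close>, of the value of \<open>\<Sum>\<^sub>j \<phi>\<^sub>j(u) q\<^sub>j(exp u)\<close>
  at \<open>u = b/N\<close>. The parameter \<open>t\<close> is \<open>1/N\<close>.\<close>

definition perturbed_eval ::
  "'j set \<Rightarrow> ('j \<Rightarrow> real ^ 'n \<Rightarrow> real) \<Rightarrow> ('j \<Rightarrow> 'n::finite laurent) \<Rightarrow> real \<Rightarrow> real ^ 'n \<Rightarrow> real" where
  "perturbed_eval S \<phi> q t u = (\<Sum>j\<in>S. \<Sum>c\<in>Poly_Mapping.keys (q j). Poly_Mapping.lookup (q j) c *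
    (\<phi> j (u - t *\<^sub>R exponent_vec c) * exp (u \<bullet> exponent_vec c - t * (norm (exponent_vec c))\<^sup>2 / 2)))"

lemma perturbed_eval_0: "perturbed_eval S \<phi> q 0 u = (\<Sum>j\<in>S. \<phi> j u * log_eval (q j) u)"
  by (simp add: perturbed_eval_def log_eval_def sum_distrib_left mult_ac)

text \<open>With \<open>t\<close> a real variable, the exact evaluation at t = 0 is an ordinary
  point of a jointly continuous function, and the tube lemma gives one neighbourhood of 0 for all of
  \<open>U\<close>.\<close>

lemma eventually_perturbed_eval_pos:
  assumes cont: "\<And>j. continuous_on UNIV (\<phi> j)" and "compact U"
    and pos: "\<And>u. u \<in> U \<Longrightarrow> perturbed_eval S \<phi> q 0 u > 0"
  shows "\<forall>\<^sub>F t in nhds 0. \<forall>u\<in>U. perturbed_eval S \<phi> q t u > 0"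
proof -
  let ?h = "\<lambda>p. perturbed_eval S \<phi> q (fst p) (snd p)"
  have "continuous_on UNIV ?h"
    unfolding perturbed_eval_def
    by (intro continuous_intros continuous_on_compose2[OF cont]) auto
  then have "open {p. 0 < ?h p}"
    by (intro open_Collect_less continuous_intros)
  then have "\<exists>X0. 0 \<in> X0 \<and> open X0 \<and> X0 \<times> U \<subseteq> {p. 0 < ?h p}"
    using pos by (intro Elementary_Topology.tube_lemma \<open>compact U\<close>) auto
  then show ?thesis
    unfolding eventually_nhds by fastforce
qed

lemma lookup_gauss_glue:
  fixes q :: "'j \<Rightarrow> 'n::finite laurent"
  shows "Poly_Mapping.lookup (\<Sum>j\<in>S. laurent_of_fun {b. norm (exponent_vec b) \<le> s}
      (\<lambda>b. \<phi> j (exponent_vec b /\<^sub>R N) * exp (- ((norm (exponent_vec b))\<^sup>2 / (2 * N)))) * q j) b =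
    (\<Sum>j\<in>S. \<Sum>c\<in>Poly_Mapping.keys (q j). Poly_Mapping.lookup (q j) c *
      (\<phi> j ((exponent_vec b - exponent_vec c) /\<^sub>R N) * trunc_gauss N s (exponent_vec b - exponent_vec c)))"
  unfolding lookup_glue
  by (intro sum.cong refl)
    (simp add: lookup_laurent_of_fun finite_bounded_exponents exponent_vec_diff trunc_gauss_def)

text \<open>Expanding the square: -|x - c|^2/2N = -|x|^2/2N + (x/N).c - |c|^2/2N. The assumption on
  \<open>s\<close> says that the truncation is not felt at any of the shifts.\<close>

lemma gauss_glue_eq_perturbed_eval:
  assumes "N > 0" and "\<And>j c. j \<in> S \<Longrightarrow> c \<in> Poly_Mapping.keys (q j) \<Longrightarrow> norm (x - exponent_vec c) \<le> s"
  shows "(\<Sum>j\<in>S. \<Sum>c\<in>Poly_Mapping.keys (q j). Poly_Mapping.lookup (q j) c *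
      (\<phi> j ((x - exponent_vec c) /\<^sub>R N) * trunc_gauss N s (x - exponent_vec c))) =
    exp (- ((norm x)\<^sup>2 / (2 * N))) * perturbed_eval S \<phi> q (1 / N) (x /\<^sub>R N)"
proof -
  have "trunc_gauss N s (x - exponent_vec c) = exp (- ((norm x)\<^sup>2 / (2 * N))) *
      exp ((x /\<^sub>R N) \<bullet> exponent_vec c - (1 / N) * (norm (exponent_vec c))\<^sup>2 / 2)"
    if "j \<in> S" "c \<in> Poly_Mapping.keys (q j)" for j c
  proof -
    have "(norm (x - exponent_vec c))\<^sup>2 = (norm x)\<^sup>2 - 2 * (x \<bullet> exponent_vec c) + (norm (exponent_vec c))\<^sup>2"
      by (simp add: power2_norm_eq_inner inner_diff_left inner_diff_right inner_commute)
    note square = this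
    have "- ((norm (x - exponent_vec c))\<^sup>2 / (2 * N)) = - ((norm x)\<^sup>2 / (2 * N)) +
        ((x /\<^sub>R N) \<bullet> exponent_vec c - (1 / N) * (norm (exponent_vec c))\<^sup>2 / 2)"
      unfolding square using \<open>N > 0\<close> by (simp add: field_simps)
    then show ?thesis
      using assms(2)[OF that] by (simp add: trunc_gauss_def flip: exp_add)
  qed
  moreover have "(x - exponent_vec c) /\<^sub>R N = x /\<^sub>R N - (1 / N) *\<^sub>R exponent_vec c" for c
    by (simp add: scaleR_diff_right divide_inverse)
  ultimately show ?thesis
    unfolding perturbed_eval_def sum_distrib_left
    by (intro sum.cong refl) (simp add: mult_ac)
qed

text \<open>For |b| <= (R + 2) N the coefficients are perturbed values on a compact ball. Farther
  out only \<open>f\<close> contributes, with cut-off constantly 1, so the estimate for pure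
  truncated Gaussians applies. The bumps stay far enough inside the support of the multiplier of
  \<open>f\<close> for \<open>f\<close> alone to decide every direction.\<close>

lemma ex_positive_glue:
  fixes M :: "('k::finite \<Rightarrow> 'n::finite laurent) set" and a :: "'k \<Rightarrow> int ^ 'n"
  assumes M: "is_submodule M" and "f \<in> M"
    and good: "\<And>v :: real ^ 'n. v \<noteq> 0 \<Longrightarrow> good_at a I J v f"
    and loc: "\<And>u :: real ^ 'n. \<exists>g\<in>M. \<forall>i. log_eval (g i) u > 0"
  shows "\<exists>F\<in>M. (\<forall>i. F i \<in> Apos) \<and> (\<forall>v :: real ^ 'n. v \<noteq> 0 \<longrightarrow> good_at a I J v F)"
proof -
  have pos: "\<And>i v. v \<noteq> 0 \<Longrightarrow> posdir v (f i)" using good by (simp add: good_at_def)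
  have "\<forall>\<^sub>F R in at_top. \<forall>i. \<forall>u. R \<le> norm u \<longrightarrow> 0 < log_eval (f i) u"
    by (intro eventually_all_finite eventually_log_eval_pos pos)
  \<comment> \<open>The radius \<open>s\<close> stays universally quantified because it is chosen
    only after \<open>R\<close> and \<open>N\<close>.\<close>
  moreover have "\<forall>\<^sub>F R in at_top. \<forall>i. \<forall>\<^sub>F N in at_top. \<forall>x s. R * N \<le> norm x \<longrightarrow>
      0 \<le> (\<Sum>c\<in>Poly_Mapping.keys (f i). Poly_Mapping.lookup (f i) c * trunc_gauss N s (x - exponent_vec c))"
    by (intro eventually_all_finite eventually_trunc_gauss_sum_nonneg pos)
  ultimately have "\<forall>\<^sub>F R in at_top. 0 \<le> R \<and> (\<forall>i u. R \<le> norm u \<longrightarrow> 0 < log_eval (f i) u) \<and>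
      (\<forall>i. \<forall>\<^sub>F N in at_top. \<forall>x s. R * N \<le> norm x \<longrightarrow>
      0 \<le> (\<Sum>c\<in>Poly_Mapping.keys (f i). Poly_Mapping.lookup (f i) c * trunc_gauss N s (x - exponent_vec c)))"
    using eventually_ge_at_top[of "0 :: real"] by eventually_elim blast
  from eventually_happens'[OF trivial_limit_at_top_linorder this]
  obtain R :: real where R: "0 \<le> R" "\<And>i u. R \<le> norm u \<Longrightarrow> 0 < log_eval (f i) u"
    and outer: "\<And>i. \<forall>\<^sub>F N in at_top. \<forall>x s. R * N \<le> norm x \<longrightarrow>
      0 \<le> (\<Sum>c\<in>Poly_Mapping.keys (f i). Poly_Mapping.lookup (f i) c * trunc_gauss N s (x - exponent_vec c))"
    by (elim exE conjE) (rule that; blast)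
  obtain K g e where K: "finite K" "K \<subseteq> cball 0 R" "cball 0 R \<subseteq> (\<Union>k\<in>K. ball k (e k))"
    and ge: "\<forall>k. g k \<in> M \<and> e k \<le> 1 \<and> (\<forall>u i. dist k u < e k \<longrightarrow> log_eval (g k i) u > 0)"
    using ex_finite_local_positive[OF loc, of R] by (elim exE conjE)
  have g: "g k \<in> M" and e: "e k \<le> 1" for k using ge by simp_all
  have g_pos: "log_eval (g k i) u > 0" if "dist k u < e k" for k u i using ge that by simp
  define S where "S = insert None (Some ` K)"
  define q where "q j = (case j of None \<Rightarrow> f | Some k \<Rightarrow> g k)" for j
  \<comment> \<open>Inside radius \<open>R\<close> the values of \<open>f\<close> may be negative,
    so its cut-off vanishes there; it reaches 1 at \<open>R + 1\<close>, where all tents around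
    points of \<open>K\<close> have died out.\<close>
  define \<phi> where "\<phi> j u = (case j of None \<Rightarrow> min 1 (max 0 (norm u - R)) | Some k \<Rightarrow> max 0 (e k - dist k u))"
    for j and u :: "real ^ 'n"
  have finS: "finite S" using K(1) by (simp add: S_def)
  have \<phi>_nonneg: "\<phi> j u \<ge> 0" for j u by (simp add: \<phi>_def split: option.split)
  have \<phi>_cont: "continuous_on UNIV (\<phi> j)" for j
    unfolding \<phi>_def by (cases j) (auto intro!: continuous_intros)
  have \<phi>_None: "\<phi> None u = 1" if "R + 1 \<le> norm u" for u
    using that by (simp add: \<phi>_def)
  have \<phi>_Some: "\<phi> (Some k) u = 0" if "k \<in> K" "R + 1 \<le> norm u" for k u
  proof -
    have "norm k \<le> R" using that(1) K(2) by auto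
    then have "e k \<le> dist k u"
      using that(2) e[of k] norm_triangle_ineq2[of u k] by (simp add: dist_norm norm_minus_commute)
    then show ?thesis by (simp add: \<phi>_def)
  qed
  have eval_pos: "perturbed_eval S \<phi> (\<lambda>j. q j i) 0 u > 0" for i u
  proof -
    have nonneg: "\<phi> j u * log_eval (q j i) u \<ge> 0" for j
    proof (cases j)
      case None
      then show ?thesis
        using R(2)[of u i] by (cases "R \<le> norm u") (auto simp: \<phi>_def q_def)
    next
      case (Some k)
      then show ?thesis
        using g_pos[of k u i] by (cases "dist k u < e k") (auto simp: \<phi>_def q_def)
    qed
    have "\<exists>j\<in>S. \<phi> j u * log_eval (q j i) u > 0"
    proof (cases "norm u \<le> R")
      case True
      then obtain k where "k \<in> K" "dist k u < e k" using K(3) by force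
      then show ?thesis
        using g_pos[of k u i] by (intro bexI[of _ "Some k"]) (auto simp: \<phi>_def q_def S_def)
    next
      case False
      then show ?thesis
        using R(2)[of u i] by (intro bexI[of _ None]) (auto simp: \<phi>_def q_def S_def)
    qed
    then show ?thesis
      unfolding perturbed_eval_0 using nonneg finS by (auto intro: sum_pos2)
  qed
  define Kc where "Kc = (\<Union>j\<in>S. \<Union>i. Poly_Mapping.keys (q j i))"
  define D where "D = Max (insert 0 ((\<lambda>c. norm (exponent_vec c)) ` Kc))"
  have D: "norm (exponent_vec c) \<le> D" if "j \<in> S" "c \<in> Poly_Mapping.keys (q j i)" for j i c
    unfolding D_def Kc_def using that finS by (intro Max_ge) auto
  have D_nonneg: "D \<ge> 0" unfolding D_def Kc_def using finS by (intro Max_ge) auto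
  define C where "C = real CARD('n)"
  have "C \<ge> 0" by (simp add: C_def)
  have inv_lim: "((\<lambda>N :: real. 1 / N) \<longlongrightarrow> 0) at_top"
    by (simp add: divide_inverse tendsto_inverse_0_at_top filterlim_ident)
  have "\<forall>\<^sub>F t in nhds 0. \<forall>u\<in>cball 0 (R + 2). perturbed_eval S \<phi> (\<lambda>j. q j i) t u > 0" for i
    by (intro eventually_perturbed_eval_pos \<phi>_cont compact_cball eval_pos)
  then have inner: "\<forall>\<^sub>F N in at_top. \<forall>u\<in>cball 0 (R + 2). perturbed_eval S \<phi> (\<lambda>j. q j i) (1 / N) u > 0" for i
    by (rule eventually_compose_filterlim[OF _ inv_lim])
  have "\<forall>\<^sub>F N in at_top. D + C + 1 \<le> N \<and>
      (\<forall>i. \<forall>u\<in>cball 0 (R + 2). perturbed_eval S \<phi> (\<lambda>j. q j i) (1 / N) u > 0) \<and>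
      (\<forall>i. \<forall>x s. R * N \<le> norm x \<longrightarrow>
      0 \<le> (\<Sum>c\<in>Poly_Mapping.keys (f i). Poly_Mapping.lookup (f i) c * trunc_gauss N s (x - exponent_vec c)))"
    by (intro eventually_conj eventually_all_finite inner outer eventually_ge_at_top)
  from eventually_happens'[OF trivial_limit_at_top_linorder this]
  obtain N where N: "D + C + 1 \<le> N"
    and N_inner: "\<And>i u. norm u \<le> R + 2 \<Longrightarrow> perturbed_eval S \<phi> (\<lambda>j. q j i) (1 / N) u > 0"
    and N_outer: "\<And>i x s. R * N \<le> norm x \<Longrightarrow>
      0 \<le> (\<Sum>c\<in>Poly_Mapping.keys (f i). Poly_Mapping.lookup (f i) c * trunc_gauss N s (x - exponent_vec c))"
    by (elim exE conjE) (rule that; force)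
  have "N > 0" using N D_nonneg \<open>C \<ge> 0\<close> by linarith
  \<comment> \<open>Bands of width \<open>N\<close>: bumps live below \<open>(R + 1) * N\<close>,
    the case split comes at \<open>(R + 2) * N\<close>, the truncation at
    \<open>(R + 3) * N\<close>. Keys have norm at most \<open>D\<close>, below \<open>N\<close>, so
    no shift crosses a whole band.\<close>
  define s where "s = (R + 3) * N"
  have s: "s = R * N + 3 * N" by (simp add: s_def distrib_right)
  define G where "G j = laurent_of_fun {b. norm (exponent_vec b) \<le> s}
      (\<lambda>b. \<phi> j (exponent_vec b /\<^sub>R N) * exp (- ((norm (exponent_vec b))\<^sup>2 / (2 * N))))" for j
  have lookup_G: "Poly_Mapping.lookup (G j) b = (if norm (exponent_vec b) \<le> s then
      \<phi> j (exponent_vec b /\<^sub>R N) * exp (- ((norm (exponent_vec b))\<^sup>2 / (2 * N))) else 0)" for j b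
    by (simp add: G_def lookup_laurent_of_fun finite_bounded_exponents)
  define F where "F = (\<lambda>i. \<Sum>j\<in>S. G j * q j i)"
  have norm_div: "R + 1 \<le> norm (x /\<^sub>R N) \<longleftrightarrow> R * N + N \<le> norm x" for x :: "real ^ 'n"
    using \<open>N > 0\<close> by (simp add: field_simps)
  have "F \<in> M"
    unfolding F_def using M finS \<open>f \<in> M\<close> g by (intro is_submodule_sum) (auto simp: q_def split: option.split)
  have coeff_nonneg: "Poly_Mapping.lookup (F i) b \<ge> 0" for i b
  proof -
    define x where "x = exponent_vec b"
    have lookup_F: "Poly_Mapping.lookup (F i) b =
      (\<Sum>j\<in>S. \<Sum>c\<in>Poly_Mapping.keys (q j i). Poly_Mapping.lookup (q j i) c *
        (\<phi> j ((x - exponent_vec c) /\<^sub>R N) * trunc_gauss N s (x - exponent_vec c)))"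
      unfolding F_def G_def x_def by (rule lookup_gauss_glue)
    show ?thesis
    proof (cases "norm x \<le> R * N + 2 * N")
      case True
      have near: "norm (x - exponent_vec c) \<le> s" if "j \<in> S" "c \<in> Poly_Mapping.keys (q j i)" for j c
        using True D[OF that] N \<open>C \<ge> 0\<close> norm_triangle_ineq4[of x "exponent_vec c"] s by linarith
      have "norm (x /\<^sub>R N) \<le> R + 2"
        using True \<open>N > 0\<close> by (simp add: field_simps)
      then have "perturbed_eval S \<phi> (\<lambda>j. q j i) (1 / N) (x /\<^sub>R N) > 0"
        by (rule N_inner)
      then show ?thesis
        unfolding lookup_F
        by (subst gauss_glue_eq_perturbed_eval[where q = "\<lambda>j. q j i"]) (use \<open>N > 0\<close> near in auto)
    next
      case False
      have far: "R + 1 \<le> norm ((x - exponent_vec c) /\<^sub>R N)"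
        if "j \<in> S" "c \<in> Poly_Mapping.keys (q j i)" for j c
        unfolding norm_div
        using False D[OF that] N \<open>C \<ge> 0\<close> norm_triangle_ineq2[of x "exponent_vec c"] by linarith
      have "Poly_Mapping.lookup (F i) b = (\<Sum>j\<in>{None}. \<Sum>c\<in>Poly_Mapping.keys (q j i).
          Poly_Mapping.lookup (q j i) c *
          (\<phi> j ((x - exponent_vec c) /\<^sub>R N) * trunc_gauss N s (x - exponent_vec c)))"
        unfolding lookup_F
      proof (rule sum.mono_neutral_right[OF finS])
        show "\<forall>j\<in>S - {None}. (\<Sum>c\<in>Poly_Mapping.keys (q j i). Poly_Mapping.lookup (q j i) c *
          (\<phi> j ((x - exponent_vec c) /\<^sub>R N) * trunc_gauss N s (x - exponent_vec c))) = 0"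
        proof (intro ballI sum.neutral)
          fix j c assume j: "j \<in> S - {None}" and c: "c \<in> Poly_Mapping.keys (q j i)"
          then obtain k where k: "j = Some k" "k \<in> K" by (auto simp: S_def)
          show "Poly_Mapping.lookup (q j i) c *
            (\<phi> j ((x - exponent_vec c) /\<^sub>R N) * trunc_gauss N s (x - exponent_vec c)) = 0"
            using \<phi>_Some[OF k(2) far[OF _ c]] j k(1) by simp
        qed
      qed (simp add: S_def)
      also have "\<dots> = (\<Sum>c\<in>Poly_Mapping.keys (f i).
          Poly_Mapping.lookup (f i) c * trunc_gauss N s (x - exponent_vec c))"
      proof -
        have "\<phi> None ((x - exponent_vec c) /\<^sub>R N) = 1" if "c \<in> Poly_Mapping.keys (q None i)" for c
          using that by (intro \<phi>_None far) (simp_all add: S_def)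
        then show ?thesis by (simp add: q_def)
      qed
      also have "\<dots> \<ge> 0" using False \<open>N > 0\<close> by (intro N_outer) linarith
      finally show ?thesis .
    qed
  qed
  have good_unit: "good_at a I J v F" if v: "norm v = 1" for v
  proof -
    \<comment> \<open>Aiming at length \<open>s - C\<close> leaves room for rounding:
      \<open>b0\<close> stays in the ball of radius \<open>s\<close> and its \<open>v\<close>-degree
      is still at least \<open>s - 2 * C\<close>.\<close>
    obtain b0 where b0: "norm (exponent_vec b0 - (s - C) *\<^sub>R v) \<le> C"
      using exponent_near unfolding C_def by blast
    have "s \<ge> C" using s N D_nonneg \<open>N > 0\<close> \<open>0 \<le> R\<close> by (smt (verit) mult_nonneg_nonneg)
    have "norm (exponent_vec b0) \<le> C + norm ((s - C) *\<^sub>R v)"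
      using b0 norm_triangle_sub[of "exponent_vec b0" "(s - C) *\<^sub>R v"] by linarith
    then have b0_le: "norm (exponent_vec b0) \<le> s"
      using v \<open>s \<ge> C\<close> by simp
    have "\<bar>v \<bullet> (exponent_vec b0 - (s - C) *\<^sub>R v)\<bar> \<le> C"
      using Cauchy_Schwarz_ineq2[of v "exponent_vec b0 - (s - C) *\<^sub>R v"] b0 v by simp
    moreover have "v \<bullet> (exponent_vec b0 - (s - C) *\<^sub>R v) = vdot v b0 - (s - C)"
      using v by (simp add: inner_diff_right vdot_eq_inner norm_eq_1)
    ultimately have b0_ge: "vdot v b0 \<ge> s - 2 * C" by linarith
    have norm_ge: "\<bar>vdot v b\<bar> \<le> norm (exponent_vec b)" for b
      using Cauchy_Schwarz_ineq2[of v "exponent_vec b"] v by (simp add: vdot_eq_inner)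
    have "R * N + N \<le> norm (exponent_vec b0)"
      using b0_ge norm_ge[of b0] s N D_nonneg by linarith
    then have b0_key: "b0 \<in> Poly_Mapping.keys (G None)"
      using \<phi>_None[of "exponent_vec b0 /\<^sub>R N"] b0_le unfolding norm_div
      by (simp add: in_keys_iff lookup_G)
    show ?thesis
      unfolding F_def
    proof (rule good_at_glue[where S' = "{None}" and D = D and l = None])
      show "\<bar>vdot v c\<bar> \<le> D" if "j \<in> S" "c \<in> Poly_Mapping.keys (q j i)" for j i c
        using D[OF that] norm_ge[of c] by linarith
      show "\<exists>j'\<in>{None}. \<exists>b'\<in>Poly_Mapping.keys (G j'). vdot v b + 2 * D < vdot v b'"
        if j: "j \<in> S - {None}" and b: "b \<in> Poly_Mapping.keys (G j)" for j b
      proof -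
        obtain k where k: "j = Some k" "k \<in> K" using j by (auto simp: S_def)
        have "\<phi> j (exponent_vec b /\<^sub>R N) \<noteq> 0"
          using b by (auto simp: in_keys_iff lookup_G split: if_splits)
        then have "norm (exponent_vec b) < R * N + N"
          using \<phi>_Some[OF k(2), of "exponent_vec b /\<^sub>R N"] k(1) unfolding norm_div by (auto simp: not_le[symmetric])
        \<comment> \<open>Bump exponents have degree below \<open>(R + 1) * N\<close>, so the margin
          exceeds 2 N - 2 C, and \<open>D + C + 1 \<le> N\<close> makes this larger than
          \<open>2 * D\<close>.\<close>
        then have "vdot v b + 2 * D < vdot v b0"
          using norm_ge[of b] b0_ge s N by linarith
        then show ?thesis using b0_key by blast
      qed
      show "0 \<le> Poly_Mapping.lookup (G j) b" for j b
        by (simp add: lookup_G \<phi>_nonneg)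
      show "good_at a I J v (q j)" if "j \<in> {None}" for j
      proof -
        have "v \<noteq> 0" using v by auto
        then show ?thesis using that good by (simp add: q_def)
      qed
    qed (use finS b0_key in \<open>auto simp: S_def\<close>)
  qed
  have good_F: "good_at a I J v F" if "v \<noteq> 0" for v
    using good_unit[of "sgn v"] good_at_scaleR[of "norm v" a I J "sgn v" F] that
    by (simp add: norm_sgn sgn_div_norm)
  \<comment> \<open>Nonvanishing is part of \<open>posdir\<close>, so one unit vector suffices; a
    standard basis vector exists as index types are nonempty.\<close>
  have "F i \<noteq> 0" for i
    using good_unit[of "axis undefined 1"] by (simp add: good_at_def posdir_def)
  then show ?thesis
    using \<open>F \<in> M\<close> coeff_nonneg good_F by (auto simp: Apos_def)
qed

section \<open>The local-global principle\<close>

lemma evalL_pos: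
  assumes "f \<in> Apos" "\<And>j. r $ j > 0"
  shows "evalL f r > 0"
proof -
  have "Poly_Mapping.lookup f b > 0" if "b \<in> Poly_Mapping.keys f" for b
    using assms(1) that by (auto simp: Apos_def in_keys_iff order_less_le)
  moreover have "Poly_Mapping.keys f \<noteq> {}" using assms(1) by (auto simp: Apos_def)
  ultimately show ?thesis
    unfolding evalL_def using assms(2)
    by (intro sum_pos mult_pos_pos prod_pos zero_less_power_int) auto
qed

theorem mainTheorem9:
  fixes M :: "('k::finite \<Rightarrow> 'n::finite laurent) set"
    and a :: "'k \<Rightarrow> int ^ 'n"
    and I J :: "'k set"
  assumes "is_submodule M"
  shows "(\<exists>f\<in>M. (\<forall>i. f i \<in> Apos) \<and>
            (\<forall>v::real^'n. v \<noteq> 0 \<longrightarrow> (Ov a v \<union> J) \<inter> Mv v I f \<noteq> {}))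
    \<longleftrightarrow>
         ((\<forall>r::real^'n. (\<forall>j. r $ j > 0) \<longrightarrow>
              (\<exists>fr\<in>M. \<forall>i. evalL (fr i) r > 0))
          \<and>
          (\<forall>v::real^'n. v \<noteq> 0 \<longrightarrow>
              (\<exists>fv\<in>M. (\<forall>i. initv v (fv i) \<in> Apos) \<and>
                 (\<forall>w::real^'n. w \<noteq> 0 \<longrightarrow>
                    (Ov a w \<union> (Ov a v \<union> J)) \<inter> Mv w (Mv v I fv) (\<lambda>i. initv v (fv i)) \<noteq> {}))))"
  (is "?global \<longleftrightarrow> ?locR \<and> ?locInf")
proof (intro iffI conjI)
  assume ?global
  then obtain f where f: "f \<in> M" "\<And>i. f i \<in> Apos"
    and dom: "\<And>v. v \<noteq> 0 \<Longrightarrow> dominant I (Ov a v \<union> J) v f"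
    by (auto simp: dominant_iff_Mv)
  show ?locR using f evalL_pos by blast
  have "f i \<noteq> 0" for i using f(2) by (simp add: Apos_def)
  then show ?locInf
    using f dominant_initv[OF _ _ dom]
    by (intro allI impI bexI[of _ f]) (simp_all add: initv_mem_Apos_iff posdir_Apos flip: dominant_iff_Mv)
next
  assume "?locR \<and> ?locInf"
  then have locR: ?locR and locInf: ?locInf by blast+
  have "\<exists>h\<in>M. eventually (\<lambda>v'. good_at a I J v' h) (nhds v)" if "v \<noteq> 0" for v
  proof -
    from locInf[rule_format, OF that, folded dominant_iff_Mv, unfolded initv_mem_Apos_iff]
    obtain h where "h \<in> M" and h: "\<forall>i. posdir v (h i)"
      "\<forall>w. w \<noteq> 0 \<longrightarrow> dominant (Mv v I h) (Ov a w \<union> (Ov a v \<union> J)) w (\<lambda>i. initv v (h i))"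
      by (elim bexE conjE)
    have "eventually (\<lambda>v'. good_at a I J v' h) (nhds v)"
      using that h by (intro eventually_good_at) simp_all
    with \<open>h \<in> M\<close> show ?thesis by (intro bexI[of _ h])
  qed
  from ex_good_everywhere[OF assms this] obtain f where f: "f \<in> M"
    "\<And>v. v \<noteq> 0 \<Longrightarrow> good_at a I J v f" by blast
  have "\<exists>g\<in>M. \<forall>i. log_eval (g i) u > 0" for u
    using locR[rule_format, of "\<chi> i. exp (u $ i)"] by (simp add: evalL_exp)
  from ex_positive_glue[OF assms f this] show ?global
    by (auto simp: good_at_def dominant_iff_Mv)
qed

end
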